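(* In the Basic Fraenkel Model $\mathrm{BFM}$, for every integer $n\ge 1$, the principle $\mathrm{nC^-_{fin}}$ holds and the principle $\mathrm{nRC_{fin}}$ fails. That is, $\mathrm{BFM}\models\forall n\ge 1\:(\mathrm{nC^-_{fin}}\land\lnot\mathrm{nRC_{fin}})$.
   Context: For a set $x$ and $n\in\omega$, $[x]^n$ is the set of all $n$-element subsets of $x$ and $[x]^{>n}$ is the set of all finite subsets of $x$ with more than $n$ elements. $\mathrm{nRC_{fin}}$: given any infinite set $x$, there exist an infinite subset $y\subseteq x$ and a function $f\colon[y]^{>n}\to[y]^n$ such that $f(z)\subseteq z$ for all $z\in[y]^{>n}$. $\mathrm{nC^-_{fin}}$: given any infinite family $\mathcal F$ of finite sets of cardinality greater than $n$, there exist an infinite subfamily $\mathcal A\subseteq\mathcal F$ and a function $f\colon\mathcal A\to[\bigcup\mathcal A]^n$ such that $f(A)\subseteq A$ for all $A\in\mathcal A$. $\mathrm{BFM}$ is the Basic Fraenkel Model: the permutation model of $\mathrm{ZFA}$ built from a ground model of $\mathrm{ZFA}+\mathrm{AC}$ with a countably infinite set $A$ of atoms, the group of all permutations of $A$, and the normal filter generated by the pointwise stabilizers of finite subsets of $A$ (i.e. finite supports). *)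

theory Defs
  imports Main
begin

text \<open>
  A structure for the language of ZFA: a membership relation on the type \<open>'v\<close> and a constant
  for the set of atoms.  Nothing forces the relation to be well-founded in the sense of HOL, or
  \<open>\<omega>\<close> to be standard, so ``finite'', ``permutation'', ``natural number'' etc. are always
  meant internally.

  The set-theoretic notions below carry a class \<open>D\<close> and are relativised to it (all quantifiers,
  and the elements of every set, range over \<open>D\<close>).  With \<open>D = UNIV\<close> they describe what
  holds in the structure itself; with \<open>D\<close> an inner class, what holds in that class.
\<close>

record 'v zfa =
  mem :: "'v \<Rightarrow> 'v \<Rightarrow> bool"
  atoms :: 'v


section \<open>Relativised set-theoretic notions\<close>

definition ext :: "'v zfa \<Rightarrow> 'v set \<Rightarrow> 'v \<Rightarrow> 'v set" where
  "ext M D x = {z \<in> D. mem M z x}"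

definition is_set :: "'v zfa \<Rightarrow> 'v \<Rightarrow> bool" where
  "is_set M x \<longleftrightarrow> \<not> mem M x (atoms M)"

definition subset_of :: "'v zfa \<Rightarrow> 'v set \<Rightarrow> 'v \<Rightarrow> 'v \<Rightarrow> bool" where
  "subset_of M D y x \<longleftrightarrow> is_set M y \<and> is_set M x \<and> ext M D y \<subseteq> ext M D x"

text \<open>Kuratowski pairs: \<open>p = {{x}, {x, y}}\<close>.\<close>

definition is_pair :: "'v zfa \<Rightarrow> 'v set \<Rightarrow> 'v \<Rightarrow> 'v \<Rightarrow> 'v \<Rightarrow> bool" where
  "is_pair M D p x y \<longleftrightarrow>
     (\<exists>s\<in>D. \<exists>t\<in>D. ext M D s = {x} \<and> ext M D t = {x, y} \<and> ext M D p = {s, t})"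

definition maps_to :: "'v zfa \<Rightarrow> 'v set \<Rightarrow> 'v \<Rightarrow> 'v \<Rightarrow> 'v \<Rightarrow> bool" where
  "maps_to M D f x y \<longleftrightarrow> (\<exists>p \<in> ext M D f. is_pair M D p x y)"

text \<open>The set \<open>f\<close> is a function \<open>X \<rightarrow> Y\<close>, where \<open>X\<close> and \<open>Y\<close> are given by their
  extensions (subclasses of \<open>D\<close>).\<close>

definition is_fun :: "'v zfa \<Rightarrow> 'v set \<Rightarrow> 'v \<Rightarrow> 'v set \<Rightarrow> 'v set \<Rightarrow> bool" where
  "is_fun M D f X Y \<longleftrightarrow>
     is_set M f \<and>
     (\<forall>p \<in> ext M D f. \<exists>x\<in>X. \<exists>y\<in>Y. is_pair M D p x y) \<and>
     (\<forall>x\<in>X. \<exists>!y. y \<in> Y \<and> maps_to M D f x y)"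

definition is_bij :: "'v zfa \<Rightarrow> 'v set \<Rightarrow> 'v \<Rightarrow> 'v set \<Rightarrow> 'v set \<Rightarrow> bool" where
  "is_bij M D f X Y \<longleftrightarrow>
     is_fun M D f X Y \<and> (\<forall>y\<in>Y. \<exists>!x. x \<in> X \<and> maps_to M D f x y)"

definition is_inductive :: "'v zfa \<Rightarrow> 'v set \<Rightarrow> 'v \<Rightarrow> bool" where
  "is_inductive M D I \<longleftrightarrow>
     is_set M I \<and>
     (\<exists>z \<in> ext M D I. is_set M z \<and> ext M D z = {}) \<and>
     (\<forall>k \<in> ext M D I. \<exists>s \<in> ext M D I. ext M D s = insert k (ext M D k))"

text \<open>The von Neumann natural numbers: the members of all inductive sets.\<close>

definition omega :: "'v zfa \<Rightarrow> 'v set \<Rightarrow> 'v set" where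
  "omega M D = {n \<in> D. \<forall>I\<in>D. is_inductive M D I \<longrightarrow> mem M n I}"

definition has_card :: "'v zfa \<Rightarrow> 'v set \<Rightarrow> 'v \<Rightarrow> 'v \<Rightarrow> bool" where
  "has_card M D x n \<longleftrightarrow> is_set M x \<and> (\<exists>f\<in>D. is_bij M D f (ext M D n) (ext M D x))"

definition finite_set :: "'v zfa \<Rightarrow> 'v set \<Rightarrow> 'v \<Rightarrow> bool" where
  "finite_set M D x \<longleftrightarrow> (\<exists>n \<in> omega M D. has_card M D x n)"

definition infinite_set :: "'v zfa \<Rightarrow> 'v set \<Rightarrow> 'v \<Rightarrow> bool" where
  "infinite_set M D x \<longleftrightarrow> is_set M x \<and> \<not> finite_set M D x"

definition finite_gt :: "'v zfa \<Rightarrow> 'v set \<Rightarrow> 'v \<Rightarrow> 'v \<Rightarrow> bool" where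
  "finite_gt M D x n \<longleftrightarrow> (\<exists>m \<in> omega M D. mem M n m \<and> has_card M D x m)"


section \<open>The choice principles\<close>

text \<open>\<open>[Y]\<^sup>n\<close> and \<open>[Y]\<^sup>>\<^sup>n\<close>, for \<open>Y\<close> given by its extension.\<close>

definition subsets_eq :: "'v zfa \<Rightarrow> 'v set \<Rightarrow> 'v set \<Rightarrow> 'v \<Rightarrow> 'v set" where
  "subsets_eq M D Y n = {z \<in> D. is_set M z \<and> ext M D z \<subseteq> Y \<and> has_card M D z n}"

definition subsets_gt :: "'v zfa \<Rightarrow> 'v set \<Rightarrow> 'v set \<Rightarrow> 'v \<Rightarrow> 'v set" where
  "subsets_gt M D Y n = {z \<in> D. is_set M z \<and> ext M D z \<subseteq> Y \<and> finite_gt M D z n}"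

definition nRC_fin :: "'v zfa \<Rightarrow> 'v set \<Rightarrow> 'v \<Rightarrow> bool" where
  "nRC_fin M D n \<longleftrightarrow>
     (\<forall>x\<in>D. infinite_set M D x \<longrightarrow>
       (\<exists>y\<in>D. subset_of M D y x \<and> infinite_set M D y \<and>
         (\<exists>f\<in>D. is_fun M D f (subsets_gt M D (ext M D y) n) (subsets_eq M D (ext M D y) n) \<and>
           (\<forall>z \<in> subsets_gt M D (ext M D y) n. \<forall>w\<in>D.
              maps_to M D f z w \<longrightarrow> subset_of M D w z))))"

definition nC_fin_minus :: "'v zfa \<Rightarrow> 'v set \<Rightarrow> 'v \<Rightarrow> bool" where
  "nC_fin_minus M D n \<longleftrightarrow>
     (\<forall>F\<in>D. infinite_set M D F \<and> (\<forall>X \<in> ext M D F. finite_gt M D X n) \<longrightarrow>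
       (\<exists>B\<in>D. subset_of M D B F \<and> infinite_set M D B \<and>
         (\<exists>f\<in>D. is_fun M D f (ext M D B) (subsets_eq M D (\<Union>X \<in> ext M D B. ext M D X) n) \<and>
           (\<forall>X \<in> ext M D B. \<forall>w\<in>D. maps_to M D f X w \<longrightarrow> subset_of M D w X))))"


section \<open>Ground models: ZFA + AC\<close>

datatype fm = Mem nat nat | Eq nat nat | Neg fm | Conj fm fm | Forall nat fm

primrec sat :: "'v zfa \<Rightarrow> (nat \<Rightarrow> 'v) \<Rightarrow> fm \<Rightarrow> bool" where
  "sat M e (Mem i j) \<longleftrightarrow> mem M (e i) (e j)"
| "sat M e (Eq i j) \<longleftrightarrow> e i = e j"
| "sat M e (Neg \<phi>) \<longleftrightarrow> \<not> sat M e \<phi>"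
| "sat M e (Conj \<phi> \<psi>) \<longleftrightarrow> sat M e \<phi> \<and> sat M e \<psi>"
| "sat M e (Forall i \<phi>) \<longleftrightarrow> (\<forall>a. sat M (e(i := a)) \<phi>)"

text \<open>
  Separation and Replacement are the first-order schemes.  The assignment \<open>e\<close> supplies
  arbitrary parameters, in particular the set of atoms, so the formulas need no symbol for it.
  Atoms have no elements but differ from the empty set, which is the only memberless object
  outside \<open>atoms M\<close>.
\<close>

definition ax_atoms :: "'v zfa \<Rightarrow> bool" where
  "ax_atoms M \<longleftrightarrow> (\<forall>a z. mem M a (atoms M) \<longrightarrow> \<not> mem M z a)"

definition ax_extensionality :: "'v zfa \<Rightarrow> bool" where
  "ax_extensionality M \<longleftrightarrow>
     (\<forall>x y. is_set M x \<and> is_set M y \<and> (\<forall>z. mem M z x \<longleftrightarrow> mem M z y) \<longrightarrow> x = y)"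

definition ax_foundation :: "'v zfa \<Rightarrow> bool" where
  "ax_foundation M \<longleftrightarrow>
     (\<forall>x. (\<exists>z. mem M z x) \<longrightarrow> (\<exists>z. mem M z x \<and> \<not> (\<exists>w. mem M w z \<and> mem M w x)))"

definition ax_pairing :: "'v zfa \<Rightarrow> bool" where
  "ax_pairing M \<longleftrightarrow> (\<forall>x y. \<exists>p. \<forall>z. mem M z p \<longleftrightarrow> z = x \<or> z = y)"

definition ax_union :: "'v zfa \<Rightarrow> bool" where
  "ax_union M \<longleftrightarrow>
     (\<forall>x. \<exists>u. is_set M u \<and> (\<forall>z. mem M z u \<longleftrightarrow> (\<exists>y. mem M y x \<and> mem M z y)))"

definition ax_power :: "'v zfa \<Rightarrow> bool" where
  "ax_power M \<longleftrightarrow>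
     (\<forall>x. \<exists>p. is_set M p \<and>
        (\<forall>z. mem M z p \<longleftrightarrow> is_set M z \<and> (\<forall>w. mem M w z \<longrightarrow> mem M w x)))"

definition ax_infinity :: "'v zfa \<Rightarrow> bool" where
  "ax_infinity M \<longleftrightarrow> (\<exists>I. is_inductive M UNIV I)"

definition ax_separation :: "'v zfa \<Rightarrow> bool" where
  "ax_separation M \<longleftrightarrow>
     (\<forall>\<phi> e x. \<exists>y. is_set M y \<and> (\<forall>z. mem M z y \<longleftrightarrow> mem M z x \<and> sat M (e(0 := z)) \<phi>))"

definition ax_replacement :: "'v zfa \<Rightarrow> bool" where
  "ax_replacement M \<longleftrightarrow>
     (\<forall>\<phi> e x. (\<forall>u. mem M u x \<longrightarrow> (\<exists>!v. sat M (e(0 := u, 1 := v)) \<phi>)) \<longrightarrow>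
        (\<exists>y. is_set M y \<and>
          (\<forall>v. mem M v y \<longleftrightarrow> (\<exists>u. mem M u x \<and> sat M (e(0 := u, 1 := v)) \<phi>))))"

definition model_ZFA :: "'v zfa \<Rightarrow> bool" where
  "model_ZFA M \<longleftrightarrow>
     ax_atoms M \<and> ax_extensionality M \<and> ax_foundation M \<and> ax_pairing M \<and> ax_union M \<and>
     ax_power M \<and> ax_infinity M \<and> ax_separation M \<and> ax_replacement M"

definition model_AC :: "'v zfa \<Rightarrow> bool" where
  "model_AC M \<longleftrightarrow>
     (\<forall>F. is_set M F \<and> (\<forall>X \<in> ext M UNIV F. ext M UNIV X \<noteq> {}) \<longrightarrow>
       (\<exists>f. is_fun M UNIV f (ext M UNIV F) (\<Union>X \<in> ext M UNIV F. ext M UNIV X) \<and>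
         (\<forall>X \<in> ext M UNIV F. \<forall>w. maps_to M UNIV f X w \<longrightarrow> mem M w X)))"

definition countable_atoms :: "'v zfa \<Rightarrow> bool" where
  "countable_atoms M \<longleftrightarrow> (\<exists>f. is_bij M UNIV f (omega M UNIV) (ext M UNIV (atoms M)))"


section \<open>The Basic Fraenkel Model\<close>

definition perms :: "'v zfa \<Rightarrow> 'v set" where
  "perms M = {\<pi>. is_bij M UNIV \<pi> (ext M UNIV (atoms M)) (ext M UNIV (atoms M))}"

definition transitive_set :: "'v zfa \<Rightarrow> 'v \<Rightarrow> bool" where
  "transitive_set M t \<longleftrightarrow>
     is_set M t \<and> (\<forall>y \<in> ext M UNIV t. ext M UNIV y \<subseteq> ext M UNIV t)"

text \<open>
  \<open>perm_app M \<pi> x y\<close> says \<open>y = \<pi> x\<close> for the extension of \<open>\<pi>\<close> to the universe by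
  \<open>\<in>\<close>-recursion, \<open>\<pi> x = {\<pi> u. u \<in> x}\<close> for sets \<open>x\<close>.  The recursion is the one of the
  ground model: some set function \<open>g\<close> on a transitive set containing \<open>x\<close> obeys the
  recursion equations and sends \<open>x\<close> to \<open>y\<close>.
\<close>

definition perm_app :: "'v zfa \<Rightarrow> 'v \<Rightarrow> 'v \<Rightarrow> 'v \<Rightarrow> bool" where
  "perm_app M \<pi> x y \<longleftrightarrow>
     (\<exists>t g. transitive_set M t \<and> mem M x t \<and> is_fun M UNIV g (ext M UNIV t) UNIV \<and>
        maps_to M UNIV g x y \<and>
        (\<forall>z \<in> ext M UNIV t. \<forall>v. maps_to M UNIV g z v \<longrightarrow>
           (if is_set M z
            then is_set M v \<and> ext M UNIV v = {w. \<exists>u \<in> ext M UNIV z. maps_to M UNIV g u w}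
            else maps_to M UNIV \<pi> z v)))"

definition fix_group :: "'v zfa \<Rightarrow> 'v \<Rightarrow> 'v set" where
  "fix_group M s = {\<pi> \<in> perms M. \<forall>a \<in> ext M UNIV s. perm_app M \<pi> a a}"

definition sym_group :: "'v zfa \<Rightarrow> 'v \<Rightarrow> 'v set" where
  "sym_group M x = {\<pi> \<in> perms M. perm_app M \<pi> x x}"

text \<open>
  The groups \<open>fix_group M s\<close>, for \<open>s\<close> a finite set of atoms, are closed under finite
  intersections and conjugation, so a subgroup belongs to the normal filter they generate iff it
  includes one of them.
\<close>

definition in_fin_filter :: "'v zfa \<Rightarrow> 'v set \<Rightarrow> bool" where
  "in_fin_filter M H \<longleftrightarrow>
     (\<exists>s. subset_of M UNIV s (atoms M) \<and> finite_set M UNIV s \<and> fix_group M s \<subseteq> H)"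

definition symmetric :: "'v zfa \<Rightarrow> 'v \<Rightarrow> bool" where
  "symmetric M x \<longleftrightarrow> in_fin_filter M (sym_group M x)"

text \<open>The transitive closure of \<open>{x}\<close>.\<close>

definition trcl_sing :: "'v zfa \<Rightarrow> 'v \<Rightarrow> 'v set" where
  "trcl_sing M x = {y. \<forall>t. transitive_set M t \<and> mem M x t \<longrightarrow> mem M y t}"

definition BFM :: "'v zfa \<Rightarrow> 'v set" where
  "BFM M = {x. \<forall>y \<in> trcl_sing M x. symmetric M y}"

end

theory Submission
  imports Defs
begin

text \<open>
  Work in \<open>M\<close> with the action of the permutations of the atoms.  The engine is a statement
  about supports: if \<open>w \<union> {a}\<close> supports \<open>x\<close> but \<open>w\<close> does not, then for
  \<open>\<pi>, \<rho>\<close> fixing \<open>w\<close> pointwise, \<open>\<pi> x = \<rho> x\<close> iff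
  \<open>\<pi> a = \<rho> a\<close>; hence no finite set of atoms supports all \<open>\<pi> x\<close>.  Since a bijection
  in \<open>BFM\<close> between a natural number and a set has a finite support, which then supports every
  element of the set, the elements of a finite set \<open>X\<close> are supported by every support of
  \<open>X\<close>.

  For the positive part let \<open>s\<close> support the family \<open>F\<close>.  If \<open>s\<close> supports all
  members of \<open>F\<close>, then any choice function of \<open>M\<close> on the sets of \<open>n\<close>-subsets works.
  Otherwise some \<open>X \<in> F\<close> is supported by some \<open>w \<union> {a}\<close> but not by
  \<open>w\<close>, where \<open>w \<supseteq> s\<close>.  The orbit of \<open>X\<close> under the pointwise stabilizer of
  \<open>w\<close> is an infinite subfamily, and \<open>\<pi> X \<mapsto> \<pi> Y\<close>, for a fixed \<open>n\<close>-subset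
  \<open>Y\<close> of \<open>X\<close>, is well defined because \<open>\<pi> a\<close> determines \<open>\<pi> Y\<close>.

  For the negative part take the set of atoms and a function \<open>f\<close> with support \<open>s\<close>.  On
  an \<open>(n + 1)\<close>-element set \<open>z\<close> of atoms disjoint from \<open>s\<close>, the transposition of a
  point of \<open>f z\<close> and the point outside it fixes \<open>f\<close> and \<open>z\<close> but not
  \<open>f z\<close>.

  As \<open>M\<close> may be nonstandard, finiteness and induction are internal to \<open>M\<close>, so every
  predicate used in an induction, separation or replacement has to be shown first-order definable.
\<close>


section \<open>Definability with parameters\<close>

primrec rename_vars :: "(nat \<Rightarrow> nat) \<Rightarrow> fm \<Rightarrow> fm" where
  "rename_vars f (Mem i j) = Mem (f i) (f j)"
| "rename_vars f (Eq i j) = Eq (f i) (f j)"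
| "rename_vars f (Neg \<phi>) = Neg (rename_vars f \<phi>)"
| "rename_vars f (Conj \<phi> \<psi>) = Conj (rename_vars f \<phi>) (rename_vars f \<psi>)"
| "rename_vars f (Forall i \<phi>) = Forall (f i) (rename_vars f \<phi>)"

text \<open>Bound variables are renamed along with the free ones. Injectivity of \<open>f\<close>
  prevents capture: an update at \<open>f i\<close> changes the pulled-back environment at
  \<open>i\<close> only.\<close>

lemma sat_rename_vars: "inj f \<Longrightarrow> sat M e (rename_vars f \<phi>) \<longleftrightarrow> sat M (e \<circ> f) \<phi>"
proof (induction \<phi> arbitrary: e)
  case (Forall i \<phi>)
  have "e(f i := a) \<circ> f = (e \<circ> f)(i := a)" for a
    using \<open>inj f\<close> by (auto simp: fun_eq_iff inj_eq)
  then show ?case using Forall by (simp del: fun_upd_apply comp_apply)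
qed auto

definition weave :: "(nat \<Rightarrow> 'a) \<Rightarrow> (nat \<Rightarrow> 'a) \<Rightarrow> nat \<Rightarrow> 'a" where
  "weave e p i = (if even i then e (i div 2) else p (i div 2))"

text \<open>The even variables of the formula carry the environment, the odd ones the parameters.\<close>

definition definable :: "'v zfa \<Rightarrow> ((nat \<Rightarrow> 'v) \<Rightarrow> bool) \<Rightarrow> bool" where
  "definable M P \<longleftrightarrow> (\<exists>\<phi> p. \<forall>e. P e \<longleftrightarrow> sat M (weave e p) \<phi>)"

text \<open>The language has no function symbols, so a term is a variable (\<open>k\<close> even) or
  a parameter (\<open>k\<close> odd). Set-theoretic operations enter formulas only through definable
  equations.\<close>

definition is_term :: "((nat \<Rightarrow> 'v) \<Rightarrow> 'v) \<Rightarrow> bool" where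
  "is_term t \<longleftrightarrow> (\<exists>k p. \<forall>e. t e = weave e p k)"

text \<open>To combine two formulas, their parameter lists \<open>p\<close> and \<open>q\<close> are
  merged into \<open>weave p q\<close>. \<open>left_index\<close> sends the variable of
  \<open>p j\<close> to its place in the merged list, \<open>right_index\<close> does so for
  \<open>q j\<close>, and both leave the environment variables alone.\<close>

definition left_index :: "nat \<Rightarrow> nat" where
  "left_index i = (if even i then i else 2 * i - 1)"

definition right_index :: "nat \<Rightarrow> nat" where
  "right_index i = (if even i then i else 2 * i + 1)"

lemma left_index_right_index_cases:
  obtains j where "i = 2 * j" "left_index i = 2 * j" "right_index i = 2 * j"
  | j where "i = 2 * j + 1" "left_index i = 2 * (2 * j) + 1" "right_index i = 2 * (2 * j + 1) + 1"
proof (cases "even i")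
  case True
  then show ?thesis using that(1)[of "i div 2"] by (simp add: left_index_def right_index_def)
next
  case False
  then obtain j where "i = 2 * j + 1" by (rule oddE)
  then show ?thesis using that(2)[of j] by (simp add: left_index_def right_index_def)
qed

lemma inj_left_index: "inj left_index" and inj_right_index: "inj right_index"
  unfolding inj_def left_index_def right_index_def by (auto split: if_splits; presburger)+

lemma weave_even [simp]: "weave e p (2 * j) = e j"
  and weave_odd [simp]: "weave e p (Suc (2 * j)) = p j"
  by (simp_all add: weave_def)

lemma weave_left_index: "weave e (weave p q) (left_index i) = weave e p i"
  by (rule left_index_right_index_cases[of i]) (simp_all only: weave_even weave_odd Suc_eq_plus1[symmetric])

lemma weave_right_index: "weave e (weave p q) (right_index i) = weave e q i"
  by (rule left_index_right_index_cases[of i]) (simp_all only: weave_even weave_odd Suc_eq_plus1[symmetric])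

lemma weave_comp_left_index: "weave e (weave p q) \<circ> left_index = weave e p"
  by (simp add: fun_eq_iff weave_left_index)

lemma weave_comp_right_index: "weave e (weave p q) \<circ> right_index = weave e q"
  by (simp add: fun_eq_iff weave_right_index)

section \<open>Closure properties of definable predicates\<close>

lemma is_term_var: "is_term (\<lambda>e. e i)"
  unfolding is_term_def by (rule exI[of _ "2 * i"]) simp

lemma is_term_const: "is_term (\<lambda>e. c)"
  unfolding is_term_def by (rule exI[of _ 1], rule exI[of _ "\<lambda>_. c"]) (simp add: weave_def)

lemma definable_mem:
  assumes "is_term t" "is_term s"
  shows "definable M (\<lambda>e. mem M (t e) (s e))"
proof -
  obtain k p l q where "\<And>e. t e = weave e p k" "\<And>e. s e = weave e q l"
    using assms unfolding is_term_def by metis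
  then show ?thesis unfolding definable_def
    by (intro exI[of _ "Mem (left_index k) (right_index l)"] exI[of _ "weave p q"])
       (simp add: weave_left_index weave_right_index)
qed

lemma definable_eq:
  assumes "is_term t" "is_term s"
  shows "definable M (\<lambda>e. t e = s e)"
proof -
  obtain k p l q where "\<And>e. t e = weave e p k" "\<And>e. s e = weave e q l"
    using assms unfolding is_term_def by metis
  then show ?thesis unfolding definable_def
    by (intro exI[of _ "Eq (left_index k) (right_index l)"] exI[of _ "weave p q"])
       (simp add: weave_left_index weave_right_index)
qed

lemma definable_not: "definable M P \<Longrightarrow> definable M (\<lambda>e. \<not> P e)"
  unfolding definable_def by (metis sat.simps(3))

lemma definable_conj:
  assumes "definable M P" "definable M Q"
  shows "definable M (\<lambda>e. P e \<and> Q e)"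
proof -
  obtain \<phi> p \<psi> q where "\<And>e. P e \<longleftrightarrow> sat M (weave e p) \<phi>" "\<And>e. Q e \<longleftrightarrow> sat M (weave e q) \<psi>"
    using assms unfolding definable_def by metis
  then show ?thesis unfolding definable_def
    by (intro exI[of _ "Conj (rename_vars left_index \<phi>) (rename_vars right_index \<psi>)"] exI[of _ "weave p q"])
       (simp add: sat_rename_vars inj_left_index inj_right_index weave_comp_left_index weave_comp_right_index)
qed

lemma definable_const: "definable M (\<lambda>e. B)"
proof -
  have "definable M (\<lambda>e. e 0 = e 0)" by (intro definable_eq is_term_var)
  then show ?thesis using definable_not[of M "\<lambda>e. e 0 = e 0"] by (cases B) auto
qed

lemma definable_disj: "definable M P \<Longrightarrow> definable M Q \<Longrightarrow> definable M (\<lambda>e. P e \<or> Q e)"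
  using definable_not[OF definable_conj[OF definable_not[of M P] definable_not[of M Q]]] by simp

lemma definable_imp: "definable M P \<Longrightarrow> definable M Q \<Longrightarrow> definable M (\<lambda>e. P e \<longrightarrow> Q e)"
  using definable_not[OF definable_conj[of M P, OF _ definable_not[of M Q]]] by simp

lemma definable_iff: "definable M P \<Longrightarrow> definable M Q \<Longrightarrow> definable M (\<lambda>e. P e \<longleftrightarrow> Q e)"
  using definable_conj[OF definable_imp[of M P Q] definable_imp[of M Q P]] by (simp add: iff_conv_conj_imp)

lemma definable_if: "definable M P \<Longrightarrow> definable M Q \<Longrightarrow> definable M R \<Longrightarrow> definable M (\<lambda>e. if P e then Q e else R e)"
  using definable_conj[OF definable_imp[of M P Q] definable_imp[OF definable_not[of M P], of R]]
  by (simp add: if_bool_eq_conj)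

text \<open>The renaming for a quantifier: the bound value moves from index 0 to index 1, the other
  environment variables slide down by one place, and the parameters slide up by one place to vacate
  index 1. In the shifted parameter list that place holds a dummy \<open>undefined\<close>, which
  the quantifier overwrites.\<close>

definition shift_index :: "nat \<Rightarrow> nat" where
  "shift_index i = (if i = 0 then 1 else if even i then i - 2 else i + 2)"

lemma inj_shift_index: "inj shift_index"
  unfolding inj_def shift_index_def by (auto split: if_splits; presburger)

text \<open>Quantifiers bind in de Bruijn style: the body sees the new value as variable 0.\<close>

lemma definable_all:
  assumes "definable M (\<lambda>e. P (\<lambda>i. e (Suc i)) (e 0))"
  shows "definable M (\<lambda>e. \<forall>a. P e a)"
proof -
  obtain \<phi> p where P: "\<And>e. P (\<lambda>i. e (Suc i)) (e 0) \<longleftrightarrow> sat M (weave e p) \<phi>"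
    using assms unfolding definable_def by metis
  have "P e a \<longleftrightarrow> sat M ((weave e (case_nat undefined p))(Suc 0 := a)) (rename_vars shift_index \<phi>)" for e a
  proof -
    have "(weave e (case_nat undefined p))(Suc 0 := a) \<circ> shift_index = weave (case_nat a e) p"
    proof
      fix i
      consider "i = 0" | j where "i = 2 * Suc j" | j where "i = Suc (2 * j)"
        by (metis Suc_eq_plus1 evenE mult_0_right not0_implies_Suc oddE)
      then show "((weave e (case_nat undefined p))(Suc 0 := a) \<circ> shift_index) i = weave (case_nat a e) p i"
      proof cases
        case 1 then show ?thesis using weave_even[of "case_nat a e" p 0] by (simp add: shift_index_def)
      next
        case 2
        then have "shift_index i = 2 * j" by (simp add: shift_index_def)
        moreover have "2 * j \<noteq> Suc 0" by presburger
        ultimately show ?thesis using 2 by (simp del: mult_Suc_right)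
      next
        case 3
        then have "shift_index i = Suc (2 * Suc j)" by (simp add: shift_index_def)
        then show ?thesis using 3 by (simp del: mult_Suc_right)
      qed
    qed
    then show ?thesis using P[of "case_nat a e"] by (simp add: sat_rename_vars inj_shift_index)
  qed
  then show ?thesis unfolding definable_def
    by (intro exI[of _ "Forall (Suc 0) (rename_vars shift_index \<phi>)"] exI[of _ "case_nat undefined p"])
       (auto simp del: fun_upd_apply)
qed

lemma definable_ex: "definable M (\<lambda>e. P (\<lambda>i. e (Suc i)) (e 0)) \<Longrightarrow> definable M (\<lambda>e. \<exists>a. P e a)"
  using definable_not[OF definable_all[of M "\<lambda>e a. \<not> P e a"]] definable_not by fastforce

lemma is_term_shift: "is_term t \<Longrightarrow> is_term (\<lambda>e. t (\<lambda>i. e (Suc i)))"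
proof -
  assume "is_term t"
  then obtain k p where t: "\<And>e. t e = weave e p k" unfolding is_term_def by metis
  show ?thesis
  proof (cases "even k")
    case True
    then have "(\<lambda>e. t (\<lambda>i. e (Suc i))) = (\<lambda>e. e (Suc (k div 2)))" by (auto simp: t weave_def)
    then show ?thesis using is_term_var by metis
  next
    case False
    then have "(\<lambda>e. t (\<lambda>i. e (Suc i))) = (\<lambda>e. p (k div 2))" by (auto simp: t weave_def)
    then show ?thesis using is_term_const by metis
  qed
qed

named_theorems definable_intros

lemmas [definable_intros] = is_term_var is_term_const definable_mem definable_eq definable_not definable_conj definable_disj definable_imp definable_iff
  definable_if definable_all definable_ex definable_const

text \<open>Substitution is simulated by an existential quantifier, so formulas themselves need no
  substitution operation. A notion can thus be shown definable once for variables and then used with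
  arbitrary terms.\<close>

lemma definable_inst1:
  assumes "definable M (\<lambda>e. R (e 0))" "is_term x"
  shows "definable M (\<lambda>e. R (x e))"
proof -
  have "definable M (\<lambda>e. \<exists>a. a = x e \<and> R a)"
    by (intro definable_ex definable_conj definable_eq is_term_var assms(2)[THEN is_term_shift] assms(1))
  then show ?thesis by simp
qed

lemma definable_inst2:
  assumes "definable M (\<lambda>e. R (e 0) (e 1))" "is_term x" "is_term y"
  shows "definable M (\<lambda>e. R (x e) (y e))"
proof -
  \<comment> \<open>The innermost quantifier provides variable 0, so \<open>b\<close> is bound
    before \<open>a\<close> to match the variables in \<open>assms(1)\<close>.\<close>
  have "definable M (\<lambda>e. \<exists>b a. a = x e \<and> b = y e \<and> R a b)"
    using assms(1)
    by (intro definable_ex definable_conj definable_eq is_term_var assms(2,3)[THEN is_term_shift, THEN is_term_shift]) simp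
  then show ?thesis by simp
qed

lemma definable_inst3:
  assumes "definable M (\<lambda>e. R (e 0) (e 1) (e 2))" "is_term x" "is_term y" "is_term z"
  shows "definable M (\<lambda>e. R (x e) (y e) (z e))"
proof -
  have "definable M (\<lambda>e. \<exists>c b a. a = x e \<and> b = y e \<and> c = z e \<and> R a b c)"
    using assms(1)
    by (intro definable_ex definable_conj definable_eq is_term_var assms(2-4)[THEN is_term_shift, THEN is_term_shift, THEN is_term_shift])
       (simp add: numeral_2_eq_2)
  then show ?thesis by simp
qed

section \<open>Definability of the set-theoretic notions\<close>

lemma ext_UNIV [simp]: "z \<in> ext M UNIV x \<longleftrightarrow> mem M z x"
  by (simp add: ext_def)

lemma definable_is_set [definable_intros]: "is_term x \<Longrightarrow> definable M (\<lambda>e. is_set M (x e))"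
  unfolding is_set_def by (intro definable_intros)

lemma definable_is_pair [definable_intros]:
  "is_term p \<Longrightarrow> is_term x \<Longrightarrow> is_term y \<Longrightarrow> definable M (\<lambda>e. is_pair M UNIV (p e) (x e) (y e))"
  by (rule definable_inst3[of M "is_pair M UNIV"])
     (simp add: is_pair_def set_eq_iff, intro definable_intros)

lemma definable_maps_to [definable_intros]:
  "is_term f \<Longrightarrow> is_term x \<Longrightarrow> is_term y \<Longrightarrow> definable M (\<lambda>e. maps_to M UNIV (f e) (x e) (y e))"
  by (rule definable_inst3[of M "maps_to M UNIV"])
     (simp add: maps_to_def Bex_def, intro definable_intros)

lemma definable_is_bij [definable_intros]:
  "is_term f \<Longrightarrow> is_term x \<Longrightarrow> is_term y \<Longrightarrow> definable M (\<lambda>e. is_bij M UNIV (f e) (ext M UNIV (x e)) (ext M UNIV (y e)))"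
  by (rule definable_inst3[of M "\<lambda>f x y. is_bij M UNIV f (ext M UNIV x) (ext M UNIV y)"])
     (simp add: is_bij_def is_fun_def Bex_def Ball_def Ex1_def, intro definable_intros)

lemma definable_has_card [definable_intros]:
  "is_term x \<Longrightarrow> is_term y \<Longrightarrow> definable M (\<lambda>e. has_card M UNIV (x e) (y e))"
  by (rule definable_inst2[of M "has_card M UNIV"]) (simp add: has_card_def, intro definable_intros)

lemma definable_is_inductive [definable_intros]: "is_term x \<Longrightarrow> definable M (\<lambda>e. is_inductive M UNIV (x e))"
  by (rule definable_inst1[of M "is_inductive M UNIV"])
     (simp add: is_inductive_def Bex_def Ball_def set_eq_iff, intro definable_intros)

lemma definable_omega [definable_intros]: "is_term x \<Longrightarrow> definable M (\<lambda>e. x e \<in> omega M UNIV)"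
  by (rule definable_inst1[of M "\<lambda>x. x \<in> omega M UNIV"]) (simp add: omega_def, intro definable_intros)

lemma definable_finite_set [definable_intros]: "is_term x \<Longrightarrow> definable M (\<lambda>e. finite_set M UNIV (x e))"
  by (rule definable_inst1[of M "finite_set M UNIV"]) (simp add: finite_set_def Bex_def, intro definable_intros)

lemma definable_transitive_set [definable_intros]: "is_term x \<Longrightarrow> definable M (\<lambda>e. transitive_set M (x e))"
  by (rule definable_inst1[of M "transitive_set M"])
     (simp add: transitive_set_def Ball_def subset_iff, intro definable_intros)

lemma definable_perms [definable_intros]: "is_term x \<Longrightarrow> definable M (\<lambda>e. x e \<in> perms M)"
  by (rule definable_inst1[of M "\<lambda>x. x \<in> perms M"]) (simp add: perms_def, intro definable_intros)

lemma definable_trcl_sing [definable_intros]: "is_term x \<Longrightarrow> is_term y \<Longrightarrow> definable M (\<lambda>e. x e \<in> trcl_sing M (y e))"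
  by (rule definable_inst2[of M "\<lambda>x y. x \<in> trcl_sing M y"]) (simp add: trcl_sing_def, intro definable_intros)

lemma definable_perm_app [definable_intros]:
  "is_term p \<Longrightarrow> is_term x \<Longrightarrow> is_term y \<Longrightarrow> definable M (\<lambda>e. perm_app M (p e) (x e) (y e))"
  by (rule definable_inst3[of M "perm_app M"])
     (simp add: perm_app_def is_fun_def Bex_def Ball_def Ex1_def set_eq_iff, intro definable_intros)

lemma definable_fix_group [definable_intros]:
  "is_term x \<Longrightarrow> is_term y \<Longrightarrow> definable M (\<lambda>e. x e \<in> fix_group M (y e))"
  by (rule definable_inst2[of M "\<lambda>x y. x \<in> fix_group M y"])
     (simp add: fix_group_def Ball_def, intro definable_intros)


section \<open>Sets coded in a model of ZFA\<close>

abbreviation Ext :: "'v zfa \<Rightarrow> 'v \<Rightarrow> 'v set" where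
  "Ext M \<equiv> ext M UNIV"

locale zfa_model =
  fixes M :: "'v zfa"
  assumes model: "model_ZFA M"
begin

lemmas axs = model[unfolded model_ZFA_def]

lemma atom_empty: "mem M a (atoms M) \<Longrightarrow> \<not> mem M z a"
  using axs unfolding ax_atoms_def by blast

lemma is_setI: "mem M z x \<Longrightarrow> is_set M x"
  using atom_empty unfolding is_set_def by blast

lemma set_ext: "is_set M x \<Longrightarrow> is_set M y \<Longrightarrow> (\<And>z. mem M z x \<longleftrightarrow> mem M z y) \<Longrightarrow> x = y"
  using axs unfolding ax_extensionality_def by blast

lemma separation:
  assumes "definable M (\<lambda>e. P (e 0))"
  obtains y where "is_set M y" "\<And>z. mem M z y \<longleftrightarrow> mem M z x \<and> P z"
proof -
  obtain \<phi> p where P: "\<And>e. P (e 0) \<longleftrightarrow> sat M (weave e p) \<phi>"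
    using assms unfolding definable_def by metis
  \<comment> \<open>Index 0 of the woven assignment is slot 0 of the environment, so the update
    commutes with weaving.\<close>
  have "(weave (\<lambda>_. undefined) p)(0 := z) = weave ((\<lambda>_. undefined)(0 := z)) p" for z
    by (auto simp: weave_def fun_eq_iff elim: evenE)
  then have "sat M ((weave (\<lambda>_. undefined) p)(0 := z)) \<phi> \<longleftrightarrow> P z" for z
    using P[of "(\<lambda>_. undefined)(0 := z)"] by simp
  then show thesis using axs that unfolding ax_separation_def by metis
qed

lemma replacement:
  assumes "definable M (\<lambda>e. R (e 0) (e 1))" "\<And>u. mem M u x \<Longrightarrow> \<exists>!v. R u v"
  obtains y where "is_set M y" "\<And>v. mem M v y \<longleftrightarrow> (\<exists>u. mem M u x \<and> R u v)"
proof -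
  obtain \<phi> p where R: "\<And>e. R (e 0) (e 1) \<longleftrightarrow> sat M (weave e p) \<phi>"
    using assms unfolding definable_def by metis
  \<comment> \<open>The axiom scheme reads \<open>v\<close> from index 1, whereas weaving puts slot
    1 of the environment at index 2. The transposition \<open>f\<close> reconciles the two.\<close>
  define f where "f = id(Suc 0 := 2, 2 := Suc 0 :: nat)"
  define e where "e = weave (\<lambda>_. undefined) p \<circ> f"
  have f: "inj f" by (auto simp: f_def inj_def)
  have "e(0 := u, 1 := v) \<circ> f = weave ((\<lambda>_. undefined)(0 := u, 1 := v)) p" for u v
  proof
    fix i :: nat
    consider "i = 0" | "i = 1" | "i = 2" | "i \<noteq> 0" "i \<noteq> 1" "i \<noteq> 2" by auto
    then show "(e(0 := u, 1 := v) \<circ> f) i = weave ((\<lambda>_. undefined)(0 := u, 1 := v)) p i"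
      by cases (auto simp: e_def f_def weave_def elim!: evenE)
  qed
  then have "sat M (e(0 := u, 1 := v)) (rename_vars f \<phi>) \<longleftrightarrow> R u v" for u v
    using R[of "(\<lambda>_. undefined)(0 := u, 1 := v)"] f by (simp add: sat_rename_vars del: comp_apply)
  note S = this
  have rep: "ax_replacement M" using axs by blast
  have "\<forall>u. mem M u x \<longrightarrow> (\<exists>!v. sat M (e(0 := u, 1 := v)) (rename_vars f \<phi>))"
    unfolding S using assms(2) by blast
  then have "\<exists>y. is_set M y \<and>
      (\<forall>v. mem M v y \<longleftrightarrow> (\<exists>u. mem M u x \<and> sat M (e(0 := u, 1 := v)) (rename_vars f \<phi>)))"
    by (rule rep[unfolded ax_replacement_def, THEN spec[of _ "rename_vars f \<phi>"], THEN spec[of _ e],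
          THEN spec[of _ x], THEN mp])
  then show thesis using that unfolding S by blast
qed

section \<open>Classes coded by sets of the model\<close>

definition small :: "'v set \<Rightarrow> bool" where
  "small S \<longleftrightarrow> (\<exists>x. is_set M x \<and> Ext M x = S)"

text \<open>Going back and forth between \<open>mk\<close> and \<open>Ext M\<close> lets set theory
  in the model be done with HOL set operations. The condition \<open>is_set\<close> makes the code
  unique, as atoms also have empty extension.\<close>

definition mk :: "'v set \<Rightarrow> 'v" where
  "mk S = (THE x. is_set M x \<and> Ext M x = S)"

lemma mk_unique: "is_set M x \<Longrightarrow> Ext M x = S \<Longrightarrow> mk S = x"
  unfolding mk_def by (rule the_equality) (auto intro!: set_ext)

lemma mk_Ext [simp]: "is_set M x \<Longrightarrow> mk (Ext M x) = x"
  by (rule mk_unique) auto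

lemma
  assumes "small S"
  shows is_set_mk: "is_set M (mk S)" and Ext_mk: "Ext M (mk S) = S"
proof -
  obtain x where x: "is_set M x" "Ext M x = S" using assms unfolding small_def by auto
  then show "is_set M (mk S)" "Ext M (mk S) = S" by (simp_all add: mk_unique[OF x])
qed

lemma mem_mk: "small S \<Longrightarrow> mem M z (mk S) \<longleftrightarrow> z \<in> S"
  using Ext_mk[of S] ext_UNIV[of z M "mk S"] by blast

lemma small_sep: "definable M (\<lambda>e. P (e 0)) \<Longrightarrow> small {z. mem M z x \<and> P z}"
  by (rule separation[of P x]) (auto simp: small_def)

lemma small_empty: "small {}"
  using small_sep[of "\<lambda>_. False"] definable_const by force

lemma small_Ext: "small (Ext M x)"
proof (cases "is_set M x")
  case False
  then have "Ext M x = {}" using is_setI by auto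
  then show ?thesis using small_empty by simp
qed (auto simp: small_def)

lemma small_subset:
  assumes "small S" "T \<subseteq> S" "definable M (\<lambda>e. e 0 \<in> T)"
  shows "small T"
proof -
  have "T = {z. mem M z (mk S) \<and> z \<in> T}" using assms by (auto simp: mem_mk)
  then show ?thesis using small_sep[of "\<lambda>z. z \<in> T" "mk S"] assms by simp
qed

lemma small_insert2: "small {x, y}"
proof -
  have "ax_pairing M" using axs by blast
  then obtain p where p: "\<And>z. mem M z p \<longleftrightarrow> z = x \<or> z = y"
    unfolding ax_pairing_def by meson
  have "Ext M p = {x, y}" by (simp add: p set_eq_iff)
  then show ?thesis using small_Ext[of p] by simp
qed

lemma small_Union: "small S \<Longrightarrow> small (\<Union>x\<in>S. Ext M x)"
proof -
  assume S: "small S"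
  have "ax_union M" using axs by blast
  then have "\<exists>u. is_set M u \<and> (\<forall>z. mem M z u \<longleftrightarrow> (\<exists>y. mem M y (mk S) \<and> mem M z y))"
    unfolding ax_union_def by (rule spec)
  then obtain u where "is_set M u" "\<And>z. mem M z u \<longleftrightarrow> (\<exists>y. mem M y (mk S) \<and> mem M z y)"
    by blast
  then show ?thesis unfolding small_def by (intro exI[of _ u]) (auto simp: mem_mk S)
qed

lemma small_Un: "small S \<Longrightarrow> small T \<Longrightarrow> small (S \<union> T)"
  using small_Union[OF small_insert2[of "mk S" "mk T"]] by (simp add: Ext_mk)

lemma small_insert: "small S \<Longrightarrow> small (insert x S)"
  using small_Un[OF small_insert2[of x x]] by simp

lemma definable_small: "small S \<Longrightarrow> is_term t \<Longrightarrow> definable M (\<lambda>e. t e \<in> S)"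
proof -
  assume S: "small S" and t: "is_term t"
  have "definable M (\<lambda>e. mem M (t e) (mk S))" using t by (intro definable_intros)
  then show ?thesis using S by (simp add: mem_mk)
qed

lemma small_Pow: "small {z. is_set M z \<and> Ext M z \<subseteq> S}" if "small S"
proof -
  have "ax_power M" using axs by blast
  then have "\<exists>p. is_set M p \<and>
      (\<forall>z. mem M z p \<longleftrightarrow> is_set M z \<and> (\<forall>w. mem M w z \<longrightarrow> mem M w (mk S)))"
    unfolding ax_power_def by (rule spec)
  then obtain p where "is_set M p"
    "\<And>z. mem M z p \<longleftrightarrow> is_set M z \<and> (\<forall>w. mem M w z \<longrightarrow> mem M w (mk S))"
    by blast
  then show ?thesis unfolding small_def by (intro exI[of _ p]) (auto simp: mem_mk that subset_iff)
qed

text \<open>Replacement. \<open>F\<close> is an arbitrary HOL function, often a definite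
  description; definability is asked of a relation \<open>R\<close> that agrees with its graph on
  \<open>S\<close>.\<close>

lemma small_image:
  assumes "small S" "definable M (\<lambda>e. R (e 0) (e 1))" "\<And>x y. x \<in> S \<Longrightarrow> R x y \<longleftrightarrow> y = F x"
  shows "small (F ` S)"
proof -
  have "\<exists>!v. R u v" if "mem M u (mk S)" for u
    using that assms(1,3) by (simp add: mem_mk)
  then obtain y where "is_set M y" "\<And>v. mem M v y \<longleftrightarrow> (\<exists>u. mem M u (mk S) \<and> R u v)"
    using replacement[OF assms(2), of "mk S"] by blast
  then have "Ext M y = F ` S"
    by (simp add: set_eq_iff image_iff Bex_def mem_mk assms cong: conj_cong)
  then show ?thesis using small_Ext[of y] by simp
qed

lemma foundation:
  assumes "small S" "S \<noteq> {}"
  obtains z where "z \<in> S" "\<And>w. mem M w z \<Longrightarrow> w \<notin> S"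
proof -
  have "ax_foundation M" "\<exists>z. mem M z (mk S)" using axs assms by (auto simp: mem_mk)
  then obtain z where "mem M z (mk S)" "\<And>w. mem M w z \<Longrightarrow> \<not> mem M w (mk S)"
    unfolding ax_foundation_def by blast
  then show thesis using that assms by (simp add: mem_mk)
qed

lemma mem_irrefl: "\<not> mem M x x"
  using foundation[OF small_insert2[of x x]] by auto

lemma mem_asym: "mem M x y \<Longrightarrow> \<not> mem M y x"
  using foundation[OF small_insert2[of x y]] by auto

lemma atoms_is_set: "is_set M (atoms M)"
  using mem_irrefl unfolding is_set_def .


subsection \<open>Ordered pairs and functions\<close>

definition pr :: "'v \<Rightarrow> 'v \<Rightarrow> 'v" where
  "pr x y = mk {mk {x}, mk {x, y}}"

lemma small_sing: "small {x}"
  using small_insert2[of x x] by simp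

text \<open>The empty class is set apart because atoms share its extension without being its
  code.\<close>

lemma Ext_eq_mk: "Ext M s = S \<and> S \<noteq> {} \<longleftrightarrow> s = mk S \<and> S \<noteq> {}" if "small S"
proof -
  have "s = mk S" if "Ext M s = S" "S \<noteq> {}"
    using that is_setI[of _ s] mk_Ext[of s] by force
  then show ?thesis using Ext_mk[OF that] by auto
qed

lemma is_pair_iff: "is_pair M UNIV p x y \<longleftrightarrow> p = pr x y"
  using Ext_eq_mk[OF small_sing, of _ x] Ext_eq_mk[OF small_insert2, of _ x y]
    Ext_eq_mk[OF small_insert2, of p]
  unfolding is_pair_def pr_def by simp

lemma pr_inject [simp]: "pr x y = pr x' y' \<longleftrightarrow> x = x' \<and> y = y'"
proof
  assume "pr x y = pr x' y'"
  then have "{mk {x}, mk {x, y}} = {mk {x'}, mk {x', y'}}"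
    unfolding pr_def using Ext_mk[OF small_insert2] by metis
  moreover have "mk S = mk T \<longleftrightarrow> S = T" if "small S" "small T" for S T
    using Ext_mk[OF that(1)] Ext_mk[OF that(2)] by metis
  ultimately show "x = x' \<and> y = y'"
    by (auto simp: small_insert2 small_sing doubleton_eq_iff)
qed simp

abbreviation mp :: "'v \<Rightarrow> 'v \<Rightarrow> 'v \<Rightarrow> bool" where
  "mp \<equiv> maps_to M UNIV"

lemma mp_iff: "mp f x y \<longleftrightarrow> mem M (pr x y) f"
  by (auto simp: maps_to_def is_pair_iff)

lemma definable_eq_pr:
  "is_term p \<Longrightarrow> is_term x \<Longrightarrow> is_term y \<Longrightarrow> definable M (\<lambda>e. p e = pr (x e) (y e))"
  using definable_is_pair[of p x y M] by (simp add: is_pair_iff)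

text \<open>Kuratowski pairs with entries in \<open>X \<union> Y\<close> belong to the double power
  set of \<open>X \<union> Y\<close>, from which separation cuts out the relation.\<close>

lemma small_rel:
  assumes "small X" "small Y" "definable M (\<lambda>e. R (e 0) (e 1))"
  shows "small {p. \<exists>x\<in>X. \<exists>y\<in>Y. R x y \<and> p = pr x y}" (is "small ?T")
proof -
  let ?P = "\<lambda>S. {z. is_set M z \<and> Ext M z \<subseteq> S}"
  have 1: "small (?P (?P (X \<union> Y)))" using assms by (intro small_Pow small_Un)
  have 2: "pr x y \<in> ?P (?P (X \<union> Y))" if "x \<in> X" "y \<in> Y" for x y
    using that by (auto simp: pr_def mem_mk is_set_mk small_insert2 small_sing)
  have "definable M (\<lambda>e. \<exists>x. x \<in> X \<and> (\<exists>y. y \<in> Y \<and> R x y \<and> e 0 = pr x y))"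
    by (intro definable_eq_pr definable_inst2[OF assms(3)] definable_small assms(1,2) definable_intros)
  then have "definable M (\<lambda>e. e 0 \<in> ?T)" by (simp only: Bex_def mem_Collect_eq)
  then show ?thesis by (rule small_subset[OF 1, rotated]) (use 2 in auto)
qed

lemma obtain_rel:
  assumes "small X" "small Y" "definable M (\<lambda>e. R (e 0) (e 1))"
  obtains f where "is_set M f"
    "\<And>p. mem M p f \<longleftrightarrow> (\<exists>x\<in>X. \<exists>y\<in>Y. R x y \<and> p = pr x y)"
    "\<And>x y. mp f x y \<longleftrightarrow> x \<in> X \<and> y \<in> Y \<and> R x y"
  using is_set_mk[OF small_rel[OF assms]] mem_mk[OF small_rel[OF assms]] that
  by (auto simp: mp_iff)

lemma is_fun_iff: "is_fun M UNIV f X Y \<longleftrightarrow> is_set M f \<and>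
    (\<forall>p. mem M p f \<longrightarrow> (\<exists>x\<in>X. \<exists>y\<in>Y. p = pr x y)) \<and> (\<forall>x\<in>X. \<exists>!y. y \<in> Y \<and> mp f x y)"
  by (simp add: is_fun_def is_pair_iff Ball_def)

lemma is_fun_mp: "is_fun M UNIV f X Y \<Longrightarrow> mp f x y \<Longrightarrow> x \<in> X \<and> y \<in> Y"
  by (force simp: is_fun_iff mp_iff)

lemma is_fun_fun: "is_fun M UNIV f X Y \<Longrightarrow> mp f x y \<Longrightarrow> mp f x y' \<Longrightarrow> y = y'"
  using is_fun_mp is_fun_iff by metis

lemma is_fun_total: "is_fun M UNIV f X Y \<Longrightarrow> x \<in> X \<Longrightarrow> \<exists>y\<in>Y. mp f x y"
  using is_fun_iff by metis

lemma is_bij_inj: "is_bij M UNIV f X Y \<Longrightarrow> mp f x y \<Longrightarrow> mp f x' y \<Longrightarrow> x = x'"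
  using is_fun_mp unfolding is_bij_def by metis

lemma is_bij_iff: "is_bij M UNIV f X Y \<longleftrightarrow> is_fun M UNIV f X Y \<and>
   (\<forall>x x' y. mp f x y \<longrightarrow> mp f x' y \<longrightarrow> x = x') \<and> (\<forall>y\<in>Y. \<exists>x\<in>X. mp f x y)"
proof -
  have "is_fun M UNIV f X Y \<Longrightarrow> is_bij M UNIV f X Y \<longleftrightarrow>
     (\<forall>x x' y. mp f x y \<longrightarrow> mp f x' y \<longrightarrow> x = x') \<and> (\<forall>y\<in>Y. \<exists>x\<in>X. mp f x y)"
    using is_fun_mp[of f X Y] unfolding is_bij_def by metis
  then show ?thesis using is_bij_def by metis
qed

lemma is_bij_fun: "is_bij M UNIV f X Y \<Longrightarrow> is_fun M UNIV f X Y"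
  by (simp add: is_bij_def)

lemma is_bij_surj: "is_bij M UNIV f X Y \<Longrightarrow> y \<in> Y \<Longrightarrow> \<exists>x\<in>X. mp f x y"
  by (simp add: is_bij_iff)

lemma obtain_fun:
  assumes "small X" "definable M (\<lambda>e. R (e 0) (e 1))" "\<And>x y. x \<in> X \<Longrightarrow> R x y \<longleftrightarrow> y = F x"
  obtains f where "is_set M f" "\<And>p. mem M p f \<longleftrightarrow> (\<exists>x\<in>X. p = pr x (F x))"
    "\<And>x y. mp f x y \<longleftrightarrow> x \<in> X \<and> y = F x" "\<And>Y. F ` X \<subseteq> Y \<Longrightarrow> is_fun M UNIV f X Y"
proof -
  obtain f where f: "is_set M f"
    "\<And>p. mem M p f \<longleftrightarrow> (\<exists>x\<in>X. \<exists>y\<in>F ` X. R x y \<and> p = pr x y)"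
    "\<And>x y. mp f x y \<longleftrightarrow> x \<in> X \<and> y \<in> F ` X \<and> R x y"
    using obtain_rel[OF assms(1) small_image[OF assms] assms(2)] by metis
  have *: "mem M p f \<longleftrightarrow> (\<exists>x\<in>X. p = pr x (F x))" for p
    using f(2) assms(3) by auto
  have **: "mp f x y \<longleftrightarrow> x \<in> X \<and> y = F x" for x y
    using f(3) assms(3) by auto
  have "is_fun M UNIV f X Y" if "F ` X \<subseteq> Y" for Y
    using that by (auto simp: is_fun_iff f(1) * **)
  then show thesis using that[OF f(1) * **] by blast
qed


section \<open>Natural numbers and finite sets in the model\<close>

definition zero :: 'v where
  "zero = mk {}"

definition succ :: "'v \<Rightarrow> 'v" where
  "succ k = mk (insert k (Ext M k))"

abbreviation om :: "'v set" where
  "om \<equiv> omega M UNIV"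

abbreviation fin :: "'v \<Rightarrow> bool" where
  "fin \<equiv> finite_set M UNIV"

lemma Ext_zero: "Ext M zero = {}" and zero_set: "is_set M zero" and not_mem_zero: "\<not> mem M z zero"
  by (simp_all add: zero_def Ext_mk small_empty is_set_mk mem_mk)

lemma eq_zero: "is_set M z \<Longrightarrow> Ext M z = {} \<Longrightarrow> z = zero"
  using mk_unique zero_def by metis

lemma zero_iff: "is_set M z \<and> Ext M z = {} \<longleftrightarrow> z = zero"
  using eq_zero zero_set Ext_zero by metis

lemma eq_zero': "is_set M z \<Longrightarrow> \<forall>w. \<not> mem M w z \<Longrightarrow> z = zero"
  by (rule eq_zero) auto

lemma Ext_succ: "Ext M (succ k) = insert k (Ext M k)"
  and mem_succ: "mem M z (succ k) \<longleftrightarrow> z = k \<or> mem M z k"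
  by (simp_all add: succ_def Ext_mk small_insert small_Ext mem_mk)

lemma succ_set: "is_set M (succ k)"
  by (simp add: succ_def is_set_mk small_insert small_Ext)

lemma succ_iff: "Ext M s = insert k (Ext M k) \<longleftrightarrow> s = succ k"
  using Ext_eq_mk[of "insert k (Ext M k)" s] by (simp add: succ_def small_insert small_Ext)

lemma definable_eq_succ:
  assumes "is_term x" "is_term y"
  shows "definable M (\<lambda>e. x e = succ (y e))"
proof -
  have "definable M (\<lambda>e. e 0 = succ (e 1))"
    unfolding succ_iff[symmetric] set_eq_iff insert_iff ext_UNIV by (intro definable_intros)
  then show ?thesis using assms by (rule definable_inst2[of M "\<lambda>x y. x = succ y"])
qed

lemma succ_neq_zero: "succ k \<noteq> zero"
  using mem_succ not_mem_zero by metis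

lemma succ_inject: "succ j = succ k \<longleftrightarrow> j = k"
  using mem_succ mem_asym by metis

lemma is_inductive_iff: "is_inductive M UNIV I \<longleftrightarrow>
    is_set M I \<and> mem M zero I \<and> (\<forall>k. mem M k I \<longrightarrow> mem M (succ k) I)"
  unfolding is_inductive_def succ_iff zero_iff by auto

lemma zero_om: "zero \<in> om"
  by (simp add: omega_def is_inductive_iff)

lemma succ_om: "k \<in> om \<Longrightarrow> succ k \<in> om"
  by (simp add: omega_def is_inductive_iff)

lemma small_om: "small om"
proof -
  obtain I where "is_inductive M UNIV I" using axs unfolding ax_infinity_def by blast
  then have "om \<subseteq> Ext M I" by (auto simp: omega_def)
  then show ?thesis by (rule small_subset[OF small_Ext]) (intro definable_intros)
qed

text \<open>Members of \<open>om\<close> lie in every inductive set of the model. To be used for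
  induction, \<open>P\<close> must therefore cut a set out of \<open>om\<close>, which is the
  purpose of the case \<open>definable\<close>.\<close>

lemma om_induct [consumes 1, case_names definable zero succ]:
  assumes "k \<in> om" "definable M (\<lambda>e. P (e 0))" "P zero" "\<And>k. k \<in> om \<Longrightarrow> P k \<Longrightarrow> P (succ k)"
  shows "P k"
proof -
  let ?S = "{k \<in> om. P k}"
  have S: "small ?S" using small_sep[OF assms(2), of "mk om"] by (simp add: mem_mk small_om)
  have "is_inductive M UNIV (mk ?S)"
    unfolding is_inductive_iff
    using assms(3,4) zero_om succ_om by (simp add: is_set_mk S mem_mk small_om)
  then have "mem M k (mk ?S)" using assms(1) by (simp add: omega_def)
  then show ?thesis by (simp add: mem_mk S)
qed

lemma om_set: "k \<in> om \<Longrightarrow> is_set M k"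
  by (induct rule: om_induct) (intro definable_intros, simp_all add: zero_set succ_set)

lemma om_mem_om:
  assumes "k \<in> om" "mem M j k"
  shows "j \<in> om"
proof -
  from assms(1) have "\<forall>j. mem M j k \<longrightarrow> j \<in> om"
    by (induct rule: om_induct) (intro definable_intros, auto simp: not_mem_zero mem_succ)
  then show ?thesis using assms(2) by blast
qed

lemma om_trans:
  assumes "k \<in> om" "mem M j k" "mem M i j"
  shows "mem M i k"
proof -
  from assms(1) have "\<forall>j i. mem M j k \<longrightarrow> mem M i j \<longrightarrow> mem M i k"
    by (induct rule: om_induct) (intro definable_intros, auto simp: not_mem_zero mem_succ)
  then show ?thesis using assms(2,3) by blast
qed

lemma zero_mem_succ: "k \<in> om \<Longrightarrow> mem M zero (succ k)"
proof (induct rule: om_induct)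
  case definable
  \<comment> \<open>\<open>succ (e 0)\<close> is not a term, so it is named by a quantified variable
    satisfying a definable equation.\<close>
  have "definable M (\<lambda>e. \<forall>s. s = succ (e 0) \<longrightarrow> mem M zero s)" by (intro definable_eq_succ definable_intros)
  then show ?case by simp
qed (auto simp: mem_succ)

lemma succ_mono:
  assumes "k \<in> om" "mem M j k"
  shows "mem M (succ j) (succ k)"
proof -
  from assms(1) have "\<forall>j. mem M j k \<longrightarrow> mem M (succ j) (succ k)"
  proof (induct rule: om_induct)
    case definable
    have "definable M (\<lambda>e. \<forall>s. s = succ (e 0) \<longrightarrow> (\<forall>j t. mem M j (e 0) \<longrightarrow> t = succ j \<longrightarrow> mem M t s))"
      by (intro definable_eq_succ definable_intros)
    then show ?case by simp
  qed (auto simp: mem_succ not_mem_zero)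
  then show ?thesis using assms(2) by blast
qed

text \<open>A substitute for the maximum that avoids comparing \<open>j\<close> and
  \<open>k\<close>: start from \<open>succ k\<close> and raise the bound by one at each step of an
  induction on \<open>j\<close>.\<close>

lemma om_bound:
  assumes "j \<in> om" "k \<in> om"
  shows "\<exists>l\<in>om. Ext M k \<subseteq> Ext M l \<and> mem M j l"
proof -
  from assms(1) have "\<exists>l. l \<in> om \<and> (\<forall>z. mem M z k \<longrightarrow> mem M z l) \<and> mem M j l"
  proof (induct rule: om_induct)
    case definable show ?case by (intro definable_intros)
  next
    case zero show ?case
      using assms(2) succ_om zero_mem_succ mem_succ by blast
  next
    case (succ j)
    then obtain l where "l \<in> om" "\<forall>z. mem M z k \<longrightarrow> mem M z l" "mem M j l" by blast
    then show ?case using succ_om succ_mono mem_succ by blast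
  qed
  then show ?thesis by (auto simp: subset_iff)
qed


subsection \<open>Cardinalities\<close>

lemma has_card_iff: "has_card M UNIV x n \<longleftrightarrow>
    is_set M x \<and> (\<exists>f. is_bij M UNIV f (Ext M n) (Ext M x))"
  by (simp add: has_card_def)

lemma is_bijI:
  assumes "is_set M f" "\<And>p. mem M p f \<Longrightarrow> \<exists>x\<in>X. \<exists>y\<in>Y. p = pr x y"
    "\<And>x. x \<in> X \<Longrightarrow> \<exists>y. mp f x y" "\<And>y. y \<in> Y \<Longrightarrow> \<exists>x. mp f x y"
    "\<And>x y y'. mp f x y \<Longrightarrow> mp f x y' \<Longrightarrow> y = y'" "\<And>x x' y. mp f x y \<Longrightarrow> mp f x' y \<Longrightarrow> x = x'"
  shows "is_bij M UNIV f X Y"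
proof -
  have "x \<in> X \<and> y \<in> Y" if "mp f x y" for x y
    using assms(2)[of "pr x y"] that by (auto simp: mp_iff)
  note * = this
  have "\<exists>!y. y \<in> Y \<and> mp f x y" if "x \<in> X" for x
    using assms(3)[OF that] assms(5) * by blast
  then have "is_fun M UNIV f X Y" unfolding is_fun_iff using assms(1,2) by simp
  moreover have "\<exists>x\<in>X. mp f x y" if "y \<in> Y" for y
    using assms(4)[OF that] * by blast
  ultimately show ?thesis unfolding is_bij_iff using assms(6) by simp
qed

lemma has_card_zero: "has_card M UNIV zero zero"
  unfolding has_card_iff Ext_zero
  by (intro conjI zero_set exI[of _ zero] is_bijI) (auto simp: zero_set not_mem_zero mp_iff)

lemma has_card_succ:
  assumes "has_card M UNIV x m" "\<not> mem M a x"
  shows "has_card M UNIV (mk (insert a (Ext M x))) (succ m)"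
proof -
  obtain f where f: "is_bij M UNIV f (Ext M m) (Ext M x)" using assms has_card_iff by blast
  have mpf: "mp f j w \<Longrightarrow> mem M j m \<and> mem M w x" for j w
    using f is_fun_mp is_bij_iff by fastforce
  obtain g where g: "is_set M g" "\<And>p. mem M p g \<longleftrightarrow> (\<exists>j\<in>Ext M (succ m). \<exists>w\<in>insert a (Ext M x).
      (mp f j w \<or> (j = m \<and> w = a)) \<and> p = pr j w)"
    "\<And>j w. mp g j w \<longleftrightarrow> j \<in> Ext M (succ m) \<and> w \<in> insert a (Ext M x) \<and> (mp f j w \<or> (j = m \<and> w = a))"
    by (rule obtain_rel[of "Ext M (succ m)" "insert a (Ext M x)" "\<lambda>j w. mp f j w \<or> (j = m \<and> w = a)"])
       (auto intro!: small_insert small_Ext definable_intros)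
  have g': "mp g j w \<longleftrightarrow> mp f j w \<or> (j = m \<and> w = a)" for j w
    using mpf[of j w] by (auto simp: g(3) Ext_succ)
  have ff: "is_fun M UNIV f (Ext M m) (Ext M x)" and
    fi: "\<And>j j' w. mp f j w \<Longrightarrow> mp f j' w \<Longrightarrow> j = j'" and fs: "\<And>w. mem M w x \<Longrightarrow> \<exists>j. mp f j w"
    using f by (auto simp: is_bij_iff)
  have "is_bij M UNIV g (Ext M (succ m)) (insert a (Ext M x))"
  proof (rule is_bijI)
    fix j assume "j \<in> Ext M (succ m)"
    then show "\<exists>w. mp g j w" using is_fun_total[OF ff, of j] by (auto simp: g' Ext_succ)
  next
    fix w assume "w \<in> insert a (Ext M x)"
    then show "\<exists>j. mp g j w" using fs by (auto simp: g')
  next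
    fix j w w' assume "mp g j w" "mp g j w'"
    then show "w = w'" using is_fun_fun[OF ff] mpf mem_irrefl unfolding g' by blast
  next
    fix j j' w assume "mp g j w" "mp g j' w"
    then show "j = j'" using fi mpf assms(2) unfolding g' by blast
  qed (use g in auto)
  then show ?thesis unfolding has_card_iff
    by (auto simp: Ext_mk is_set_mk small_insert small_Ext)
qed

section \<open>Internally finite sets\<close>

lemma fin_set: "fin x \<Longrightarrow> is_set M x"
  by (auto simp: finite_set_def has_card_def)

lemma fin_zero: "fin zero"
  using has_card_zero zero_om unfolding finite_set_def by blast

lemma fin_insert: "fin x \<Longrightarrow> fin (mk (insert a (Ext M x)))"
proof (cases "mem M a x")
  case True
  then have "insert a (Ext M x) = Ext M x" by auto
  then show "fin x \<Longrightarrow> ?thesis" using fin_set mk_Ext by simp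
next
  case False
  then show "fin x \<Longrightarrow> ?thesis" using has_card_succ succ_om unfolding finite_set_def by blast
qed

text \<open>With \<open>g\<close> a bijection from \<open>m\<close> onto \<open>s\<close>, induction
  on \<open>k\<close> shows \<open>P\<close> for the image of \<open>k\<close> under
  \<open>g\<close> as long as \<open>k\<close> is included in \<open>m\<close>; the step inserts the
  value of \<open>g\<close> at \<open>k\<close>. All stages stay inside \<open>s\<close>, and this
  is handed to the step case.\<close>

lemma fin_induct [consumes 1, case_names definable zero insert]:
  assumes "fin s" "definable M (\<lambda>e. P (e 0))" "P zero"
    "\<And>x a. is_set M x \<Longrightarrow> Ext M x \<subseteq> Ext M s \<Longrightarrow> P x \<Longrightarrow> mem M a s \<Longrightarrow> P (mk (insert a (Ext M x)))"
  shows "P s"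
proof -
  obtain m g where m: "m \<in> om" and s: "is_set M s" and g: "is_bij M UNIV g (Ext M m) (Ext M s)"
    using assms(1) unfolding finite_set_def has_card_iff by blast
  have gf: "is_fun M UNIV g (Ext M m) (Ext M s)" using g by (rule is_bij_fun)
  let ?I = "\<lambda>k x. is_set M x \<and> (\<forall>w. mem M w x \<longleftrightarrow> (\<exists>j. mem M j k \<and> mp g j w))"
  have "(\<forall>j. mem M j k \<longrightarrow> mem M j m) \<longrightarrow> (\<forall>x. ?I k x \<longrightarrow> P x)" if "k \<in> om" for k
    using that
  proof (induct rule: om_induct)
    case definable show ?case by (intro definable_intros definable_inst1[OF assms(2)])
  next
    case zero
    have "x = zero" if "?I zero x" for x using that eq_zero'[of x] by (simp add: not_mem_zero)
    then show ?case using assms(3) by blast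
  next
    case (succ k)
    show ?case
    proof (intro impI allI)
      fix x assume *: "\<forall>j. mem M j (succ k) \<longrightarrow> mem M j m" and x: "?I (succ k) x"
      let ?Y = "{w. mem M w s \<and> (\<exists>j. mem M j k \<and> mp g j w)}"
      have Y: "small ?Y" by (rule small_sep) (intro definable_intros)
      have gs: "mem M w s" if "mp g j w" for j w using is_fun_mp[OF gf that] by simp
      have "?I k (mk ?Y)" using gs by (auto simp: mem_mk Y is_set_mk)
      then have PY: "P (mk ?Y)" using succ(2) * by (auto simp: mem_succ)
      obtain a where a: "mp g k a" "mem M a s"
        using * is_fun_total[OF gf, of k] by (auto simp: mem_succ)
      then have "Ext M x = insert a ?Y"
        using x gs is_fun_fun[OF gf] unfolding mem_succ by auto
      then have "x = mk (insert a (Ext M (mk ?Y)))" using x mk_Ext[of x] by (simp add: Ext_mk Y)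
      moreover have "P (mk (insert a (Ext M (mk ?Y))))"
        by (rule assms(4)) (use a PY in \<open>auto simp: is_set_mk mem_mk Y\<close>)
      ultimately show "P x" by simp
    qed
  qed
  moreover have "?I m s" using g s is_fun_mp[OF gf] unfolding is_bij_iff by fastforce
  ultimately show ?thesis using m by blast
qed

lemma fin_subset:
  assumes "fin t" "is_set M s" "Ext M s \<subseteq> Ext M t"
  shows "fin s"
proof -
  \<comment> \<open>The claim inducted on concerns the intersection of \<open>s\<close> with the
    current set. It is stated for every \<open>y\<close> having that extension, because
    \<open>mk\<close> of the intersection is not a term.\<close>
  from assms(1) have "\<forall>y. is_set M y \<and> (\<forall>z. mem M z y \<longleftrightarrow> mem M z s \<and> mem M z t) \<longrightarrow> fin y"
  proof (induct rule: fin_induct)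
    case definable show ?case by (intro definable_intros)
  next
    case zero
    have "y = zero" if "is_set M y" "\<forall>z. mem M z y \<longleftrightarrow> mem M z s \<and> mem M z zero" for y
      using that eq_zero'[of y] by (simp add: not_mem_zero)
    then show ?case using fin_zero by blast
  next
    case (insert x a)
    show ?case
    proof (intro allI impI)
      fix y
      assume y: "is_set M y \<and> (\<forall>z. mem M z y \<longleftrightarrow> mem M z s \<and> mem M z (mk (insert a (Ext M x))))"
      let ?Y = "{z. mem M z s \<and> mem M z x}"
      have Y: "small ?Y" by (rule small_sep) (intro definable_intros)
      have fY: "fin (mk ?Y)" using insert(3) by (auto simp: mem_mk is_set_mk Y)
      have "Ext M y = (if mem M a s then insert a ?Y else ?Y)"
        using y by (simp add: set_eq_iff mem_mk small_insert small_Ext) blast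
      then have "mk (if mem M a s then insert a ?Y else ?Y) = y" using y mk_unique by blast
      then show "fin y" using fY fin_insert[OF fY, of a] by (auto simp: Ext_mk Y split: if_splits)
    qed
  qed
  then show ?thesis using assms(2,3) by (elim allE[of _ s]) auto
qed

lemma fin_Un:
  assumes "fin s" "fin t"
  shows "fin (mk (Ext M s \<union> Ext M t))"
proof -
  from assms(2) have "\<forall>y. is_set M y \<and> (\<forall>z. mem M z y \<longleftrightarrow> mem M z s \<or> mem M z t) \<longrightarrow> fin y"
  proof (induct rule: fin_induct)
    case definable show ?case by (intro definable_intros)
  next
    case zero
    have "y = s" if "is_set M y" "\<forall>z. mem M z y \<longleftrightarrow> mem M z s \<or> mem M z zero" for y
      using that set_ext[of y s] fin_set[OF assms(1)] by (simp add: not_mem_zero)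
    then show ?case using assms(1) by blast
  next
    case (insert x a)
    show ?case
    proof (intro allI impI)
      fix y
      assume y: "is_set M y \<and> (\<forall>z. mem M z y \<longleftrightarrow> mem M z s \<or> mem M z (mk (insert a (Ext M x))))"
      let ?Y = "Ext M s \<union> Ext M x"
      have Y: "small ?Y" by (intro small_Un small_Ext)
      have fY: "fin (mk ?Y)" using insert(3) by (auto simp: mem_mk is_set_mk Y)
      have "Ext M y = insert a ?Y"
        using y by (simp add: set_eq_iff mem_mk small_insert small_Ext) blast
      then have "mk (insert a ?Y) = y" using y mk_unique by blast
      then show "fin y" using fin_insert[OF fY, of a] by (simp add: Ext_mk Y)
    qed
  qed
  then show ?thesis by (auto simp: mem_mk is_set_mk small_Un small_Ext)
qed

text \<open>By induction over a finite set of atoms, the indices of its members under the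
  enumeration \<open>f\<close> all lie in some \<open>k \<in> om\<close>. If this held for all
  atoms, the atom with index \<open>k\<close> would give \<open>k \<in> k\<close>.\<close>

lemma countable_atoms_infinite:
  assumes "countable_atoms M"
  shows "\<not> fin (atoms M)"
proof
  assume "fin (atoms M)"
  obtain f where f: "is_bij M UNIV f om (Ext M (atoms M))"
    using assms unfolding countable_atoms_def by blast
  then have ff: "is_fun M UNIV f om (Ext M (atoms M))" by (rule is_bij_fun)
  from \<open>fin (atoms M)\<close>
  have "\<exists>k. k \<in> om \<and> (\<forall>a j. mem M a (atoms M) \<longrightarrow> j \<in> om \<longrightarrow> mp f j a \<longrightarrow> mem M j k)"
  proof (induct rule: fin_induct)
    case definable show ?case by (intro definable_intros)
  next
    case zero show ?case using zero_om by (auto simp: not_mem_zero)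
  next
    case (insert x a)
    then obtain k where k: "k \<in> om" "\<And>b j. mem M b x \<Longrightarrow> j \<in> om \<Longrightarrow> mp f j b \<Longrightarrow> mem M j k" by blast
    obtain i where i: "i \<in> om" "mp f i a" using is_bij_surj[OF f, of a] insert(4) by auto
    obtain l where "l \<in> om" "Ext M k \<subseteq> Ext M l" "mem M i l" using om_bound[OF i(1) k(1)] by blast
    moreover have "j = i" if "mp f j a" for j using f that i(2) unfolding is_bij_iff by blast
    ultimately show ?case using k(2) by (auto simp: mem_mk small_insert small_Ext subset_iff)
  qed
  then obtain k where "k \<in> om" "\<And>a j. mem M a (atoms M) \<Longrightarrow> j \<in> om \<Longrightarrow> mp f j a \<Longrightarrow> mem M j k" by blast
  then have "mem M k k" using is_fun_total[OF ff, of k] by auto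
  then show False using mem_irrefl by blast
qed

text \<open>Induction on \<open>n\<close>, turning a counterexample for \<open>succ n\<close> into
  one for \<open>n\<close>. Here \<open>f\<close> ranges over relations that are total into
  \<open>n\<close> and in which distinct arguments share no value.\<close>

lemma pigeonhole:
  assumes "n \<in> om"
  shows "\<not> (\<exists>f. (\<forall>j. mem M j (succ n) \<longrightarrow> (\<exists>k. mem M k n \<and> mp f j k)) \<and>
     (\<forall>i j k. mem M i (succ n) \<longrightarrow> mem M j (succ n) \<longrightarrow> mem M k n \<longrightarrow> mp f i k \<longrightarrow> mp f j k \<longrightarrow> i = j))"
  using assms
proof (induct rule: om_induct)
  case definable
  have "definable M (\<lambda>e. \<forall>s. s = succ (e 0) \<longrightarrow> \<not> (\<exists>f. (\<forall>j. mem M j s \<longrightarrow> (\<exists>k. mem M k (e 0) \<and> mp f j k)) \<and>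
     (\<forall>i j k. mem M i s \<longrightarrow> mem M j s \<longrightarrow> mem M k (e 0) \<longrightarrow> mp f i k \<longrightarrow> mp f j k \<longrightarrow> i = j)))"
    by (intro definable_eq_succ definable_intros)
  then show ?case by simp
next
  case zero show ?case using not_mem_zero mem_succ by blast
next
  case (succ n)
  show ?case
  proof
    assume "\<exists>f. (\<forall>j. mem M j (succ (succ n)) \<longrightarrow> (\<exists>k. mem M k (succ n) \<and> mp f j k)) \<and>
      (\<forall>i j k. mem M i (succ (succ n)) \<longrightarrow> mem M j (succ (succ n)) \<longrightarrow> mem M k (succ n) \<longrightarrow>
        mp f i k \<longrightarrow> mp f j k \<longrightarrow> i = j)"
    then obtain f where tot: "\<And>j. mem M j (succ (succ n)) \<Longrightarrow> \<exists>k. mem M k (succ n) \<and> mp f j k"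
      and inj: "\<And>i j k. mem M i (succ (succ n)) \<Longrightarrow> mem M j (succ (succ n)) \<Longrightarrow> mem M k (succ n) \<Longrightarrow>
        mp f i k \<Longrightarrow> mp f j k \<Longrightarrow> i = j" by blast
    \<comment> \<open>An argument sent to \<open>n\<close> is rerouted to the values of the extra
      argument \<open>succ n\<close>. Injectivity keeps \<open>succ n\<close> from being sent to
      \<open>n\<close> as well.\<close>
    let ?R = "\<lambda>j k. mp f j k \<or> (mp f j n \<and> mp f (succ n) k)"
    obtain g where g: "\<And>j k. mp g j k \<longleftrightarrow> j \<in> Ext M (succ n) \<and> k \<in> Ext M n \<and> ?R j k"
      by (rule obtain_rel[OF small_Ext small_Ext, of ?R "succ n" n]) (intro definable_intros, blast)
    have tot': "\<exists>k. mem M k n \<and> mp g j k" if j: "mem M j (succ n)" for j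
    proof -
      obtain k where k: "mem M k (succ n)" "mp f j k" using tot[of j] j mem_succ by blast
      obtain l where l: "mem M l (succ n)" "mp f (succ n) l" using tot[of "succ n"] mem_succ by blast
      have "l \<noteq> n" if "k = n"
        using inj[of j "succ n" n] that j k l mem_succ mem_irrefl by metis
      then show ?thesis using j k l unfolding g mem_succ ext_UNIV by blast
    qed
    have "i = j" if "mp g i k" "mp g j k" for i j k
    proof -
      have ij: "mem M i (succ n)" "mem M j (succ n)" "mem M k n" "?R i k" "?R j k"
        using that by (simp_all add: g)
      then have m: "mem M i (succ (succ n))" "mem M j (succ (succ n))" "mem M k (succ n)"
        "mem M n (succ n)" "mem M (succ n) (succ (succ n))"
        by (simp_all add: mem_succ)
      have "i \<noteq> succ n" "j \<noteq> succ n" using ij mem_irrefl by auto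
      then show ?thesis
        using inj[OF m(1,2,3)] inj[OF m(1,2,4)] inj[OF m(1,5,3)] inj[OF m(2,5,3)] ij(4,5) by blast
    qed
    then show False using succ(2) tot' by blast
  qed
qed

text \<open>Following \<open>g\<close> by the inverse of \<open>f\<close> on \<open>succ n\<close>,
  which is included in \<open>m\<close>, would inject \<open>succ n\<close> into
  \<open>n\<close>.\<close>

lemma has_card_neq:
  assumes "n \<in> om" "m \<in> om" "mem M n m" "has_card M UNIV x n" "has_card M UNIV x m"
  shows False
proof -
  obtain f g where f: "is_bij M UNIV f (Ext M n) (Ext M x)" and g: "is_bij M UNIV g (Ext M m) (Ext M x)"
    using assms unfolding has_card_iff by blast
  let ?R = "\<lambda>j k. \<exists>w. mp g j w \<and> mp f k w"
  obtain h where h: "\<And>j k. mp h j k \<longleftrightarrow> j \<in> Ext M (succ n) \<and> k \<in> Ext M n \<and> ?R j k"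
    by (rule obtain_rel[OF small_Ext small_Ext, of ?R "succ n" n]) (intro definable_intros, blast)
  have sub: "mem M j m" if "mem M j (succ n)" for j
    using that assms(2,3) om_trans unfolding mem_succ by blast
  have 1: "\<exists>k. mem M k n \<and> mp h j k" if "mem M j (succ n)" for j
  proof -
    have "j \<in> Ext M m" using sub[OF that] by simp
    then obtain w where "mem M w x" "mp g j w"
      using is_fun_total[OF is_bij_fun[OF g], of j] by auto
    moreover then obtain k where "mem M k n" "mp f k w" using is_bij_surj[OF f, of w] by auto
    ultimately show ?thesis using that unfolding h by auto
  qed
  have 2: "i = j" if "mp h i k" "mp h j k" for i j k
  proof -
    have "?R i k" "?R j k" using that by (simp_all add: h)
    then obtain w w' where "mp g i w" "mp f k w" "mp g j w'" "mp f k w'" by blast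
    moreover then have "w = w'" using is_fun_fun[OF is_bij_fun[OF f]] by blast
    ultimately show ?thesis using g unfolding is_bij_iff by blast
  qed
  show False using pigeonhole[OF assms(1)] 1 2 by blast
qed


subsection \<open>Recursion on the natural numbers\<close>

text \<open>A set of pairs is justified if each of its pairs follows from the recursion equations,
  possibly with the help of another of its pairs.  Unlike approximations by functions, such sets
  extend by adding a single pair.\<close>

lemma om_rec:
  assumes U: "definable M (\<lambda>e. e 1 = U (e 0))"
  obtains F where "F zero = a" "\<And>k. k \<in> om \<Longrightarrow> F (succ k) = U (F k)" "small (F ` om)"
proof -
  define J where "J g \<longleftrightarrow> (\<forall>k y. mp g k y \<longrightarrow>
     (k = zero \<and> y = a) \<or> (\<exists>j w. k = succ j \<and> y = U w \<and> mp g j w))" for g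
  define R where "R k y \<longleftrightarrow> (\<exists>g. J g \<and> mp g k y)" for k y
  have dR: "definable M (\<lambda>e. R (e 0) (e 1))"
    unfolding R_def J_def by (intro definable_eq_succ definable_inst2[OF U, of "\<lambda>e. _ e" "\<lambda>e. _ e"] definable_intros)
  have R0: "R zero y \<longleftrightarrow> y = a" for y
  proof
    assume "R zero y" then show "y = a" unfolding R_def J_def using succ_neq_zero by metis
  next
    assume "y = a"
    have "J (mk {pr zero a})" "mp (mk {pr zero a}) zero a"
      by (simp_all add: J_def mp_iff mem_mk small_sing)
    then show "R zero y" using \<open>y = a\<close> R_def by blast
  qed
  have RS: "R (succ k) y \<longleftrightarrow> (\<exists>w. R k w \<and> y = U w)" for k y
  proof
    assume "R (succ k) y" then show "\<exists>w. R k w \<and> y = U w"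
      unfolding R_def J_def using succ_neq_zero succ_inject by metis
  next
    assume "\<exists>w. R k w \<and> y = U w"
    then obtain w g where g: "J g" "mp g k w" and y: "y = U w" unfolding R_def by blast
    let ?g = "mk (insert (pr (succ k) y) (Ext M g))"
    have mpg: "mp ?g j z \<longleftrightarrow> (j = succ k \<and> z = y) \<or> mp g j z" for j z
      by (simp add: mp_iff mem_mk small_insert small_Ext)
    have "J ?g" using g y unfolding J_def mpg by metis
    then show "R (succ k) y" using mpg R_def by blast
  qed
  have ex1: "\<exists>!y. R k y" if "k \<in> om" for k
    using that
  proof (induct rule: om_induct)
    case definable
    have "definable M (\<lambda>e. \<exists>y. R (e 0) y \<and> (\<forall>z. R (e 0) z \<longrightarrow> z = y))"
      by (intro definable_intros definable_inst2[OF dR])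
    then show ?case by (simp add: Ex1_def)
  qed (use R0 RS in auto)
  define F where "F k = (THE y. R k y)" for k
  have F: "R k y \<longleftrightarrow> y = F k" if "k \<in> om" for k y
    unfolding F_def using ex1[OF that] the1_equality theI' by metis
  show thesis
  proof
    show "F zero = a" using F[OF zero_om] R0 by metis
    show "F (succ k) = U (F k)" if "k \<in> om" for k
      using F[OF that] F[OF succ_om[OF that]] RS by metis
    show "small (F ` om)" by (rule small_image[OF small_om dR F])
  qed
qed

section \<open>Transitive sets and induction on membership\<close>

lemma transitive_set_iff: "transitive_set M t \<longleftrightarrow>
    is_set M t \<and> (\<forall>y z. mem M y t \<longrightarrow> mem M z y \<longrightarrow> mem M z t)"
  by (auto simp: transitive_set_def subset_iff)

text \<open>Iterate the union operation \<open>U\<close> from \<open>{x}\<close> along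
  \<open>om\<close> and collect all stages: a member of a member of \<open>F k\<close> lies in
  \<open>F (succ k)\<close>.\<close>

lemma ex_transitive_set: "\<exists>t. transitive_set M t \<and> mem M x t"
proof -
  define U where "U y = mk (\<Union>z\<in>Ext M y. Ext M z)" for y
  have sU: "small (\<Union>z\<in>Ext M y. Ext M z)" for y by (rule small_Union[OF small_Ext])
  have memU: "mem M z (U y) \<longleftrightarrow> (\<exists>v. mem M v y \<and> mem M z v)" and setU: "is_set M (U y)" for z y
    by (simp_all add: U_def mem_mk[OF sU] is_set_mk[OF sU] Bex_def)
  have "w = U y \<longleftrightarrow> is_set M w \<and> (\<forall>z. mem M z w \<longleftrightarrow> (\<exists>v. mem M v y \<and> mem M z v))" for w y
    using set_ext[of w "U y"] setU[of y] memU[of _ y] by blast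
  moreover have "definable M (\<lambda>e. is_set M (e 1) \<and> (\<forall>z. mem M z (e 1) \<longleftrightarrow> (\<exists>v. mem M v (e 0) \<and> mem M z v)))"
    by (intro definable_intros)
  ultimately have "definable M (\<lambda>e. e 1 = U (e 0))" by simp
  then obtain F where F: "F zero = mk {x}" "\<And>k. k \<in> om \<Longrightarrow> F (succ k) = U (F k)" "small (F ` om)"
    by (rule om_rec[where a = "mk {x}"]) blast
  let ?T = "\<Union>k\<in>om. Ext M (F k)"
  have T: "small ?T" using small_Union[OF F(3)] by simp
  have "mem M z (F (succ k))" if "k \<in> om" "mem M y (F k)" "mem M z y" for k y z
    using that F(2) by (auto simp: memU)
  then have "mem M z (mk ?T)" if "mem M y (mk ?T)" "mem M z y" for y z
    using that succ_om unfolding mem_mk[OF T] UN_iff ext_UNIV by blast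
  then have "transitive_set M (mk ?T)"
    unfolding transitive_set_iff using is_set_mk[OF T] by blast
  moreover have "mem M x (F zero)" using F(1) by (simp add: mem_mk small_sing)
  then have "mem M x (mk ?T)" using zero_om unfolding mem_mk[OF T] by auto
  ultimately show ?thesis by blast
qed

text \<open>Foundation, applied to the counterexamples in a transitive set around \<open>x\<close>,
  yields one whose members all satisfy \<open>P\<close>; transitivity ensures that those members
  were under consideration.\<close>

lemma eps_induct:
  assumes "definable M (\<lambda>e. P (e 0))" "\<And>x. (\<And>y. mem M y x \<Longrightarrow> P y) \<Longrightarrow> P x"
  shows "P x"
proof (rule ccontr)
  assume "\<not> P x"
  obtain t where t: "transitive_set M t" "mem M x t" using ex_transitive_set by blast
  let ?S = "{z. mem M z t \<and> \<not> P z}"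
  have S: "small ?S" by (rule small_sep[OF definable_not[OF assms(1)]])
  have "?S \<noteq> {}" using t(2) \<open>\<not> P x\<close> by blast
  then obtain z where z: "z \<in> ?S" "\<And>w. mem M w z \<Longrightarrow> w \<notin> ?S" using foundation[OF S] by metis
  have "mem M w t" if "mem M w z" for w
    using t(1) z(1) that unfolding transitive_set_iff by blast
  then have "P z" using z(2) assms(2) by blast
  then show False using z(1) by blast
qed


section \<open>The action of permutations of the atoms\<close>

abbreviation At :: "'v set" where
  "At \<equiv> Ext M (atoms M)"

text \<open>A bisimulation for the graph of the action; unlike the functions in
  \<^const>\<open>perm_app\<close>, these need not be defined on a transitive set.\<close>

definition bisim :: "'v \<Rightarrow> 'v \<Rightarrow> bool" where
  "bisim \<pi> g \<longleftrightarrow> (\<forall>u v. mp g u v \<longrightarrow>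
     (if is_set M u
      then is_set M v \<and> (\<forall>w. mem M w v \<longrightarrow> (\<exists>u'. mem M u' u \<and> mp g u' w)) \<and>
        (\<forall>u'. mem M u' u \<longrightarrow> (\<exists>w. mem M w v \<and> mp g u' w))
      else mp \<pi> u v))"

text \<open>The union of all bisimulations that are sets. Quantifying over sets \<open>g\<close> of
  the model keeps the relation definable.\<close>

definition act_rel :: "'v \<Rightarrow> 'v \<Rightarrow> 'v \<Rightarrow> bool" where
  "act_rel \<pi> x y \<longleftrightarrow> (\<exists>g. bisim \<pi> g \<and> mp g x y)"

lemma definable_act_rel: "is_term p \<Longrightarrow> is_term x \<Longrightarrow> is_term y \<Longrightarrow> definable M (\<lambda>e. act_rel (p e) (x e) (y e))"
  by (rule definable_inst3[of M act_rel]) (simp only: act_rel_def bisim_def, intro definable_intros)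

lemma act_rel_set:
  assumes "act_rel \<pi> x y" "is_set M x"
  shows "is_set M y" "mem M w y \<Longrightarrow> \<exists>u. mem M u x \<and> act_rel \<pi> u w"
    "mem M u x \<Longrightarrow> \<exists>w. mem M w y \<and> act_rel \<pi> u w"
  using assms unfolding act_rel_def bisim_def by metis+

lemma act_rel_atom: "act_rel \<pi> x y \<Longrightarrow> \<not> is_set M x \<Longrightarrow> mp \<pi> x y"
  unfolding act_rel_def bisim_def by metis

lemma perms_fun: "\<pi> \<in> perms M \<Longrightarrow> is_fun M UNIV \<pi> At At"
  by (simp add: perms_def is_bij_fun)

text \<open>Induction on membership: if \<open>x\<close> is a set, a member of one value comes from
  a member of \<open>x\<close>, whose value is unique by hypothesis and so belongs to the other
  value too. On atoms, \<open>\<pi>\<close> is a function.\<close>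

lemma act_rel_unique:
  assumes "\<pi> \<in> perms M"
  shows "act_rel \<pi> x y \<Longrightarrow> act_rel \<pi> x y' \<Longrightarrow> y = y'"
proof -
  have "\<forall>y y'. act_rel \<pi> x y \<longrightarrow> act_rel \<pi> x y' \<longrightarrow> y = y'"
  proof (rule eps_induct)
    show "definable M (\<lambda>e. \<forall>y y'. act_rel \<pi> (e 0) y \<longrightarrow> act_rel \<pi> (e 0) y' \<longrightarrow> y = y')"
      by (intro definable_act_rel definable_intros)
  next
    fix x assume IH: "\<And>u. mem M u x \<Longrightarrow> \<forall>y y'. act_rel \<pi> u y \<longrightarrow> act_rel \<pi> u y' \<longrightarrow> y = y'"
    have sub: "mem M w y'" if x: "is_set M x" and b: "act_rel \<pi> x y" "act_rel \<pi> x y'" and w: "mem M w y" for y y' w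
    proof -
      obtain u where u: "mem M u x" "act_rel \<pi> u w" using act_rel_set(2)[OF b(1) x w] by blast
      then obtain w' where "mem M w' y'" "act_rel \<pi> u w'" using act_rel_set(3)[OF b(2) x] by blast
      then show ?thesis using IH[OF u(1)] u(2) by blast
    qed
    show "\<forall>y y'. act_rel \<pi> x y \<longrightarrow> act_rel \<pi> x y' \<longrightarrow> y = y'"
    proof (intro allI impI)
      fix y y' assume b: "act_rel \<pi> x y" "act_rel \<pi> x y'"
      show "y = y'"
      proof (cases "is_set M x")
        case True
        show ?thesis
          using set_ext[OF act_rel_set(1)[OF b(1) True] act_rel_set(1)[OF b(2) True]] sub[OF True] b by blast
      next
        case False
        then show ?thesis using is_fun_fun[OF perms_fun[OF assms]] act_rel_atom b by blast
      qed
    qed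
  qed
  then show "act_rel \<pi> x y \<Longrightarrow> act_rel \<pi> x y' \<Longrightarrow> y = y'" by blast
qed

text \<open>If all members of a set \<open>x\<close> have images, these form a set by replacement.
  Pairing \<open>x\<close> with it and adding this pair to the part of the action on a transitive
  set around \<open>x\<close> gives a bisimulation.\<close>

lemma act_rel_total:
  assumes "\<pi> \<in> perms M"
  shows "\<exists>y. act_rel \<pi> x y"
proof (rule eps_induct)
  show "definable M (\<lambda>e. \<exists>y. act_rel \<pi> (e 0) y)" by (intro definable_act_rel definable_intros)
next
  fix x assume IH: "\<And>u. mem M u x \<Longrightarrow> \<exists>y. act_rel \<pi> u y"
  \<comment> \<open>As totality is not yet known, \<open>f\<close> is meaningful only at arguments
    having some value; hence the restriction to \<open>?X\<close> below.\<close>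
  define f where "f u = (THE y. act_rel \<pi> u y)" for u
  have f: "act_rel \<pi> u y \<longleftrightarrow> y = f u" if "\<exists>y. act_rel \<pi> u y" for u y
    using that act_rel_unique[OF assms] unfolding f_def by (metis the_equality)
  have dbis: "definable M (\<lambda>e. act_rel \<pi> (e 0) (e 1))" by (intro definable_act_rel definable_intros)
  show "\<exists>y. act_rel \<pi> x y"
  proof (cases "is_set M x")
    case False
    then have "x \<in> At" by (simp add: is_set_def)
    then obtain y where y: "mp \<pi> x y" using is_fun_total[OF perms_fun[OF assms]] by blast
    have "mp (mk {pr x y}) u v \<longleftrightarrow> u = x \<and> v = y" for u v
      by (simp add: mp_iff mem_mk small_sing)
    then have "bisim \<pi> (mk {pr x y})" "mp (mk {pr x y}) x y"
      using y False unfolding bisim_def by simp_all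
    then show ?thesis unfolding act_rel_def by blast
  next
    case True
    obtain t where t: "transitive_set M t" "mem M x t" using ex_transitive_set by blast
    let ?X = "{z. mem M z t \<and> (\<exists>v. act_rel \<pi> z v)}"
    have X: "small ?X" by (rule small_sep) (intro definable_act_rel definable_intros)
    have fX: "small (f ` ?X)" by (rule small_image[OF X dbis]) (use f in blast)
    obtain g where g: "\<And>z v. mp g z v \<longleftrightarrow> z \<in> ?X \<and> v \<in> f ` ?X \<and> act_rel \<pi> z v"
      by (rule obtain_rel[OF X fX dbis]) (rule that)
    have S: "small (f ` Ext M x)" by (rule small_image[OF small_Ext dbis]) (use f IH in simp)
    let ?y = "mk (f ` Ext M x)" and ?g = "mk (insert (pr x (mk (f ` Ext M x))) (Ext M g))"
    have g': "mp ?g z v \<longleftrightarrow> (z = x \<and> v = ?y) \<or> (mem M z t \<and> act_rel \<pi> z v)" for z v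
      using g[of z v] f by (auto simp: mp_iff mem_mk small_insert small_Ext)
    have tt: "mem M u t" if "mem M u z" "mem M z t" for u z
      using t(1) that unfolding transitive_set_iff by blast
    have "bisim \<pi> ?g"
      unfolding bisim_def
    proof (intro allI impI)
      fix u v assume "mp ?g u v"
      then consider "u = x" "v = ?y" | "mem M u t" "act_rel \<pi> u v" unfolding g' by blast
      then show "if is_set M u
        then is_set M v \<and> (\<forall>w. mem M w v \<longrightarrow> (\<exists>u'. mem M u' u \<and> mp ?g u' w)) \<and>
          (\<forall>u'. mem M u' u \<longrightarrow> (\<exists>w. mem M w v \<and> mp ?g u' w))
        else mp \<pi> u v"
      proof cases
        case 1
        have *: "act_rel \<pi> u (f u)" "mem M u t" if "mem M u x" for u
          using f IH tt t(2) that by blast+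
        have "mem M w v \<longleftrightarrow> (\<exists>u'. mem M u' x \<and> w = f u')" for w
          using 1 by (auto simp: mem_mk S)
        moreover have "is_set M v" using 1 is_set_mk[OF S] by simp
        ultimately show ?thesis using True * unfolding g' 1(1) by (simp, blast)
      next
        case 2
        show ?thesis
          using act_rel_set[OF 2(2)] act_rel_atom[OF 2(2)] tt[OF _ 2(1)] unfolding g' by (simp, blast)
      qed
    qed
    then show ?thesis unfolding act_rel_def using g' by blast
  qed
qed

definition act :: "'v \<Rightarrow> 'v \<Rightarrow> 'v" where
  "act \<pi> x = (THE y. act_rel \<pi> x y)"

lemma act_rel_iff: "\<pi> \<in> perms M \<Longrightarrow> act_rel \<pi> x y \<longleftrightarrow> y = act \<pi> x"
  unfolding act_def using act_rel_unique act_rel_total by (metis the_equality)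

lemma definable_act:
  assumes "\<pi> \<in> perms M" "is_term x" "is_term y"
  shows "definable M (\<lambda>e. x e = act \<pi> (y e))"
  using definable_act_rel[OF is_term_const[of \<pi>] assms(3,2)] by (simp add: act_rel_iff assms(1))

lemma mp_perm: "\<pi> \<in> perms M \<Longrightarrow> mp \<pi> a b \<longleftrightarrow> a \<in> At \<and> b = act \<pi> a"
proof -
  assume \<pi>: "\<pi> \<in> perms M"
  have "mp \<pi> a (act \<pi> a)" if "a \<in> At"
    using act_rel_atom[of \<pi> a "act \<pi> a"] act_rel_iff[OF \<pi>] that by (simp add: is_set_def)
  then show ?thesis using is_fun_mp[OF perms_fun[OF \<pi>]] is_fun_fun[OF perms_fun[OF \<pi>]] by blast
qed

lemma is_set_act:
  assumes "\<pi> \<in> perms M"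
  shows "is_set M (act \<pi> x) \<longleftrightarrow> is_set M x"
proof
  assume "is_set M x" then show "is_set M (act \<pi> x)"
    using act_rel_set(1) act_rel_iff[OF assms] by blast
next
  assume s: "is_set M (act \<pi> x)"
  show "is_set M x"
  proof (rule ccontr)
    assume "\<not> is_set M x"
    then have "mp \<pi> x (act \<pi> x)" using act_rel_atom act_rel_iff[OF assms] by blast
    then have "act \<pi> x \<in> At" using is_fun_mp[OF perms_fun[OF assms]] by blast
    then show False using s by (simp add: is_set_def)
  qed
qed

lemma Ext_act:
  assumes "\<pi> \<in> perms M"
  shows "Ext M (act \<pi> x) = act \<pi> ` Ext M x"
proof (cases "is_set M x")
  case True
  have "act_rel \<pi> x (act \<pi> x)" using act_rel_iff[OF assms] by blast
  from act_rel_set[OF this True] show ?thesis by (auto simp: act_rel_iff[OF assms] image_iff Bex_def)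
next
  case False
  then have "\<not> is_set M (act \<pi> x)" using is_set_act[OF assms] by blast
  then have "Ext M x = {}" "Ext M (act \<pi> x) = {}" using False is_setI by auto
  then show ?thesis by simp
qed

text \<open>A function obeying the recursion equations on a transitive set is a bisimulation;
  conversely, the restriction of \<open>act \<pi>\<close> to a transitive set obeys them.\<close>

lemma perm_app_iff:
  assumes "\<pi> \<in> perms M"
  shows "perm_app M \<pi> x y \<longleftrightarrow> y = act \<pi> x"
proof
  assume "perm_app M \<pi> x y"
  then obtain t g where t: "transitive_set M t" and g: "is_fun M UNIV g (Ext M t) UNIV"
    and xy: "mp g x y" and eqs: "\<And>z v. mem M z t \<Longrightarrow> mp g z v \<Longrightarrow>
      (if is_set M z then is_set M v \<and> Ext M v = {w. \<exists>u \<in> Ext M z. mp g u w} else mp \<pi> z v)"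
    unfolding perm_app_def by auto
  have "bisim \<pi> g"
    unfolding bisim_def
  proof (intro allI impI)
    fix u v assume uv: "mp g u v"
    then have u: "mem M u t" using is_fun_mp[OF g] by simp
    have tot: "\<exists>w. mp g u' w" if "mem M u' u" for u'
      using is_fun_total[OF g, of u'] t u that unfolding transitive_set_iff by auto
    have "is_set M v \<and> (\<forall>w. mem M w v \<longleftrightarrow> (\<exists>u'. mem M u' u \<and> mp g u' w))" if "is_set M u"
      using eqs[OF u uv] that by (simp add: set_eq_iff Bex_def)
    then show "if is_set M u
      then is_set M v \<and> (\<forall>w. mem M w v \<longrightarrow> (\<exists>u'. mem M u' u \<and> mp g u' w)) \<and>
        (\<forall>u'. mem M u' u \<longrightarrow> (\<exists>w. mem M w v \<and> mp g u' w))
      else mp \<pi> u v"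
      using eqs[OF u uv] tot by (simp, blast)
  qed
  then show "y = act \<pi> x" using xy act_rel_iff[OF assms] unfolding act_rel_def by blast
next
  assume y: "y = act \<pi> x"
  obtain t where t: "transitive_set M t" "mem M x t" using ex_transitive_set by blast
  have d: "definable M (\<lambda>e. act_rel \<pi> (e 0) (e 1))" by (intro definable_act_rel definable_intros)
  obtain g where g: "\<And>z v. mp g z v \<longleftrightarrow> z \<in> Ext M t \<and> v = act \<pi> z"
    "\<And>Y. act \<pi> ` Ext M t \<subseteq> Y \<Longrightarrow> is_fun M UNIV g (Ext M t) Y"
    by (rule obtain_fun[OF small_Ext[of t] d act_rel_iff[OF assms]]) (rule that)
  have "Ext M (act \<pi> z) = {w. \<exists>u \<in> Ext M z. mp g u w}" if "mem M z t" for z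
    using t(1) that unfolding Ext_act[OF assms] transitive_set_iff g(1) by auto
  moreover have "mp \<pi> z (act \<pi> z)" if "\<not> is_set M z" for z
    using that by (simp add: mp_perm[OF assms] is_set_def)
  ultimately show "perm_app M \<pi> x y"
    unfolding perm_app_def using t g(2)[of UNIV] y
    by (intro exI[of _ t] exI[of _ g]) (simp add: g(1) is_set_act[OF assms])
qed

text \<open>Uniqueness of the recursive extension, by induction on membership. It identifies
  composites and the identity with actions of permutations.\<close>

lemma act_unique:
  assumes "\<pi> \<in> perms M" "definable M (\<lambda>e. e 1 = F (e 0))" "\<And>a. a \<in> At \<Longrightarrow> F a = act \<pi> a"
    "\<And>x. is_set M x \<Longrightarrow> is_set M (F x)" "\<And>x. is_set M x \<Longrightarrow> Ext M (F x) = F ` Ext M x"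
  shows "F x = act \<pi> x"
proof (rule eps_induct[where P = "\<lambda>x. F x = act \<pi> x" and x = x])
  have "definable M (\<lambda>e. \<exists>y. y = F (e 0) \<and> y = act \<pi> (e 0))"
    by (intro definable_act[OF assms(1)] definable_inst2[OF assms(2)] definable_intros)
  then show "definable M (\<lambda>e. F (e 0) = act \<pi> (e 0))" by simp
next
  fix x assume IH: "\<And>u. mem M u x \<Longrightarrow> F u = act \<pi> u"
  show "F x = act \<pi> x"
  proof (cases "is_set M x")
    case True
    have "F ` Ext M x = act \<pi> ` Ext M x" using IH by (intro image_cong) auto
    then have "Ext M (F x) = Ext M (act \<pi> x)" by (simp add: assms(5)[OF True] Ext_act[OF assms(1)])
    then show ?thesis using assms(4)[OF True] is_set_act[OF assms(1)] True mk_Ext by metis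
  next
    case False
    then show ?thesis using assms(3) by (simp add: is_set_def)
  qed
qed

section \<open>The group of permutations: composites, inverses, transpositions\<close>

lemma perm_bij: "\<pi> \<in> perms M \<Longrightarrow> bij_betw (act \<pi>) At At"
proof -
  assume \<pi>: "\<pi> \<in> perms M"
  then have b: "is_bij M UNIV \<pi> At At" by (simp add: perms_def)
  have "inj_on (act \<pi>) At"
    using is_bij_inj[OF b] unfolding mp_perm[OF \<pi>] inj_on_def by blast
  moreover have "act \<pi> ` At \<subseteq> At" using is_fun_mp[OF perms_fun[OF \<pi>]] unfolding mp_perm[OF \<pi>] by blast
  moreover have "At \<subseteq> act \<pi> ` At" using is_bij_surj[OF b] unfolding mp_perm[OF \<pi>] by blast
  ultimately show ?thesis unfolding bij_betw_def by blast
qed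

lemma obtain_perm:
  assumes "bij_betw h At At" "definable M (\<lambda>e. R (e 0) (e 1))" "\<And>a b. a \<in> At \<Longrightarrow> R a b \<longleftrightarrow> b = h a"
  obtains \<pi> where "\<pi> \<in> perms M" "\<And>a. a \<in> At \<Longrightarrow> act \<pi> a = h a"
proof -
  obtain f where f: "is_set M f" "\<And>p. mem M p f \<longleftrightarrow> (\<exists>x\<in>At. p = pr x (h x))"
    "\<And>x y. mp f x y \<longleftrightarrow> x \<in> At \<and> y = h x"
    by (rule obtain_fun[OF small_Ext[of "atoms M"] assms(2,3)]) (assumption, rule that)
  have inj: "inj_on h At" and im: "h ` At = At" using assms(1) by (auto simp: bij_betw_def)
  have "is_bij M UNIV f At At"
  proof (rule is_bijI)
    show "\<exists>x\<in>At. \<exists>y\<in>At. p = pr x y" if "mem M p f" for p using that im unfolding f(2) by blast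
    show "\<exists>x. mp f x y" if "y \<in> At" for y using that im unfolding f(3) by blast
    show "x = x'" if "mp f x y" "mp f x' y" for x x' y
      using that inj unfolding f(3) inj_on_def by blast
  qed (auto simp: f(1,3))
  then have \<pi>: "f \<in> perms M" by (simp add: perms_def)
  moreover have "act f a = h a" if "a \<in> At" for a using f(3) mp_perm[OF \<pi>] that by metis
  ultimately show thesis using that by blast
qed

lemma ex_comp:
  assumes "\<pi> \<in> perms M" "\<rho> \<in> perms M"
  obtains \<tau> where "\<tau> \<in> perms M" "\<And>x. act \<tau> x = act \<pi> (act \<rho> x)"
proof -
  have "definable M (\<lambda>e. \<exists>b. b = act \<rho> (e 0) \<and> e 1 = act \<pi> b)" by (intro definable_act assms definable_intros)
  then have d: "definable M (\<lambda>e. e 1 = act \<pi> (act \<rho> (e 0)))" by simp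
  have "bij_betw (\<lambda>x. act \<pi> (act \<rho> x)) At At"
    using bij_betw_trans[OF perm_bij[OF assms(2)] perm_bij[OF assms(1)]] by (simp add: comp_def)
  then obtain \<tau> where \<tau>: "\<tau> \<in> perms M" "\<And>a. a \<in> At \<Longrightarrow> act \<tau> a = act \<pi> (act \<rho> a)"
    by (rule obtain_perm[OF _ d]) auto
  have "act \<pi> (act \<rho> x) = act \<tau> x" for x
    by (rule act_unique[OF \<tau>(1) d]) (simp_all add: \<tau>(2) is_set_act Ext_act assms image_image)
  then show thesis using that \<tau>(1) by metis
qed

lemma act_id:
  assumes "\<pi> \<in> perms M" "\<And>a. a \<in> At \<Longrightarrow> act \<pi> a = a"
  shows "act \<pi> x = x"
proof -
  have "definable M (\<lambda>e. e 1 = e 0)" by (intro definable_intros)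
  then show ?thesis using act_unique[OF assms(1), of "\<lambda>x. x" x] assms(2) by simp
qed

lemma ex_inv:
  assumes "\<pi> \<in> perms M"
  obtains \<rho> where "\<rho> \<in> perms M" "\<And>x. act \<rho> (act \<pi> x) = x" "\<And>x. act \<pi> (act \<rho> x) = x"
proof -
  note b = perm_bij[OF assms]
  have d: "definable M (\<lambda>e. mem M (e 1) (atoms M) \<and> e 0 = act \<pi> (e 1))" by (intro definable_act assms definable_intros)
  have inv: "mem M y (atoms M) \<and> x = act \<pi> y \<longleftrightarrow> y = inv_into At (act \<pi>) x" if "x \<in> At" for x y
    using bij_betw_inv_into_left[OF b, of y] bij_betw_apply[OF bij_betw_inv_into[OF b] that]
      bij_betw_inv_into_right[OF b that] by auto
  obtain \<rho> where \<rho>: "\<rho> \<in> perms M" "\<And>a. a \<in> At \<Longrightarrow> act \<rho> a = inv_into At (act \<pi>) a"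
    by (rule obtain_perm[OF bij_betw_inv_into[OF b] d inv]) (assumption, rule that)
  \<comment> \<open>So far \<open>\<rho>\<close> inverts \<open>\<pi>\<close> on atoms only. The two
    composites fix every atom, hence by \<open>act_id\<close> every element of the universe.\<close>
  obtain \<sigma> where \<sigma>: "\<sigma> \<in> perms M" "\<And>x. act \<sigma> x = act \<rho> (act \<pi> x)" by (rule ex_comp[OF \<rho>(1) assms]) blast
  obtain \<tau> where \<tau>: "\<tau> \<in> perms M" "\<And>x. act \<tau> x = act \<pi> (act \<rho> x)" by (rule ex_comp[OF assms \<rho>(1)]) blast
  have "act \<sigma> a = a" if "a \<in> At" for a
    using \<sigma>(2) \<rho>(2) b that by (simp add: bij_betw_apply bij_betw_inv_into_left del: ext_UNIV)
  moreover have "act \<tau> a = a" if "a \<in> At" for a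
    using \<tau>(2) \<rho>(2) b that by (simp add: bij_betw_apply bij_betw_inv_into_right del: ext_UNIV)
  ultimately show thesis using that[OF \<rho>(1)] act_id[OF \<sigma>(1)] act_id[OF \<tau>(1)] \<sigma>(2) \<tau>(2) by simp
qed

lemma ex_swap:
  assumes "a \<in> At" "b \<in> At"
  obtains \<tau> where "\<tau> \<in> perms M" "act \<tau> a = b" "act \<tau> b = a"
    "\<And>c. c \<in> At \<Longrightarrow> c \<noteq> a \<Longrightarrow> c \<noteq> b \<Longrightarrow> act \<tau> c = c"
proof -
  let ?h = "\<lambda>c. if c = a then b else if c = b then a else c"
  let ?R = "\<lambda>x y. if x = a then y = b else if x = b then y = a else y = x"
  have "bij_betw ?h At At"
    by (rule bij_betw_byWitness[where f' = ?h]) (use assms in auto)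
  moreover have "definable M (\<lambda>e. ?R (e 0) (e 1))" by (intro definable_intros)
  ultimately obtain \<tau> where "\<tau> \<in> perms M" "\<And>c. c \<in> At \<Longrightarrow> act \<tau> c = ?h c"
    by (rule obtain_perm) auto
  then show thesis using that[of \<tau>] assms by auto
qed

section \<open>Invariance of the basic notions under the action\<close>

lemma act_inject: "\<pi> \<in> perms M \<Longrightarrow> act \<pi> x = act \<pi> y \<longleftrightarrow> x = y"
  using ex_inv by metis

lemma act_surj: "\<pi> \<in> perms M \<Longrightarrow> \<exists>x. y = act \<pi> x"
  using ex_inv by metis

lemma mem_act: "\<pi> \<in> perms M \<Longrightarrow> mem M (act \<pi> x) (act \<pi> y) \<longleftrightarrow> mem M x y"
  using Ext_act[of \<pi> y] act_inject ext_UNIV[of "act \<pi> x" M "act \<pi> y"] by (auto simp: image_iff)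

lemma act_mk:
  assumes "\<pi> \<in> perms M" "small S"
  shows "act \<pi> (mk S) = mk (act \<pi> ` S)"
  by (rule mk_unique[symmetric])
    (simp_all add: assms is_set_act is_set_mk Ext_act Ext_mk)

lemma act_pr: "\<pi> \<in> perms M \<Longrightarrow> act \<pi> (pr x y) = pr (act \<pi> x) (act \<pi> y)"
  by (simp add: pr_def act_mk small_insert2 small_sing)

lemma act_om:
  assumes "\<pi> \<in> perms M" "k \<in> om"
  shows "act \<pi> k = k"
proof -
  have "k = act \<pi> k"
    using assms(2)
  proof (induct rule: om_induct)
    case definable show ?case by (intro definable_act assms definable_intros)
  next
    case zero show ?case by (simp add: zero_def act_mk assms small_empty)
  next
    case (succ k)
    then have "act \<pi> ` Ext M k = Ext M k" using Ext_act[OF assms(1), of k] by simp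
    then show ?case using succ by (simp add: succ_def act_mk assms small_insert small_Ext)
  qed
  then show ?thesis by simp
qed

lemma mp_act: "\<pi> \<in> perms M \<Longrightarrow> mp (act \<pi> f) (act \<pi> x) (act \<pi> y) \<longleftrightarrow> mp f x y"
  by (simp add: mp_iff act_pr[symmetric] mem_act)

lemma is_bij_act:
  assumes "\<pi> \<in> perms M" "is_bij M UNIV f X Y"
  shows "is_bij M UNIV (act \<pi> f) (act \<pi> ` X) (act \<pi> ` Y)"
proof (rule is_bijI)
  note f = is_bij_fun[OF assms(2)]
  have mp: "\<exists>x' y'. x = act \<pi> x' \<and> y = act \<pi> y' \<and> mp f x' y'" if "mp (act \<pi> f) x y" for x y
    using that act_surj[OF assms(1)] mp_act[OF assms(1)] by metis
  show "is_set M (act \<pi> f)" using f by (simp add: is_set_act assms(1) is_fun_iff)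
  show "\<exists>x\<in>act \<pi> ` X. \<exists>y\<in>act \<pi> ` Y. p = pr x y" if p: "mem M p (act \<pi> f)" for p
  proof -
    obtain q where q: "p = act \<pi> q" using act_surj[OF assms(1)] by blast
    then obtain x y where "x \<in> X" "y \<in> Y" "q = pr x y"
      using p mem_act[OF assms(1)] f unfolding is_fun_iff by blast
    then show ?thesis using q by (auto simp: act_pr assms(1))
  qed
  show "\<exists>y. mp (act \<pi> f) x y" if "x \<in> act \<pi> ` X" for x
    using that is_fun_total[OF f] mp_act[OF assms(1)] by blast
  show "\<exists>x. mp (act \<pi> f) x y" if "y \<in> act \<pi> ` Y" for y
    using that is_bij_surj[OF assms(2)] mp_act[OF assms(1)] by blast
  show "y = y'" if "mp (act \<pi> f) x y" "mp (act \<pi> f) x y'" for x y y'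
    using mp[OF that(1)] mp[OF that(2)] is_fun_fun[OF f] act_inject[OF assms(1)] by metis
  show "x = x'" if "mp (act \<pi> f) x y" "mp (act \<pi> f) x' y" for x x' y
    using mp[OF that(1)] mp[OF that(2)] is_bij_inj[OF assms(2)] act_inject[OF assms(1)] by metis
qed

lemma fin_act:
  assumes "\<pi> \<in> perms M" "fin s"
  shows "fin (act \<pi> s)"
proof -
  obtain m f where m: "m \<in> om" "is_set M s" "is_bij M UNIV f (Ext M m) (Ext M s)"
    using assms(2) unfolding finite_set_def has_card_iff by blast
  have "act \<pi> ` Ext M m = Ext M m" using act_om[OF assms(1) m(1)] Ext_act[OF assms(1), of m] by simp
  then have "is_bij M UNIV (act \<pi> f) (Ext M m) (Ext M (act \<pi> s))"
    using is_bij_act[OF assms(1) m(3)] by (simp add: Ext_act assms(1))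
  then show ?thesis using m is_set_act[OF assms(1)] unfolding finite_set_def has_card_iff by blast
qed

lemma transitive_set_act: "\<pi> \<in> perms M \<Longrightarrow> transitive_set M t \<Longrightarrow> transitive_set M (act \<pi> t)"
  unfolding transitive_set_def by (auto simp: is_set_act Ext_act image_subset_iff)


section \<open>Supports\<close>

definition fin_atoms :: "'v \<Rightarrow> bool" where
  "fin_atoms s \<longleftrightarrow> fin s \<and> Ext M s \<subseteq> At"

definition supp :: "'v \<Rightarrow> 'v \<Rightarrow> bool" where
  "supp s x \<longleftrightarrow> (\<forall>\<pi>\<in>fix_group M s. act \<pi> x = x)"

definition cup :: "'v \<Rightarrow> 'v \<Rightarrow> 'v" where
  "cup s t = mk (Ext M s \<union> Ext M t)"

definition ins :: "'v \<Rightarrow> 'v \<Rightarrow> 'v" where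
  "ins a s = mk (insert a (Ext M s))"

lemma fix_iff: "\<pi> \<in> fix_group M s \<longleftrightarrow> \<pi> \<in> perms M \<and> (\<forall>a. mem M a s \<longrightarrow> act \<pi> a = a)"
  by (auto simp: fix_group_def perm_app_iff eq_commute)

lemma fix_perms: "\<pi> \<in> fix_group M s \<Longrightarrow> \<pi> \<in> perms M"
  by (simp add: fix_iff)

lemma symmetric_iff: "symmetric M x \<longleftrightarrow> (\<exists>s. fin_atoms s \<and> supp s x)"
proof -
  have "fix_group M s \<subseteq> sym_group M x \<longleftrightarrow> supp s x" for s
    unfolding supp_def sym_group_def using fix_perms perm_app_iff by (auto simp: eq_commute)
  moreover have "subset_of M UNIV s (atoms M) \<and> fin s \<longleftrightarrow> fin_atoms s" for s
    using fin_set atoms_is_set by (auto simp: subset_of_def fin_atoms_def)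
  ultimately show ?thesis unfolding symmetric_def in_fin_filter_def by blast
qed

lemma Ext_cup: "Ext M (cup s t) = Ext M s \<union> Ext M t"
  and mem_cup: "mem M z (cup s t) \<longleftrightarrow> mem M z s \<or> mem M z t"
  by (simp_all add: cup_def Ext_mk mem_mk small_Un small_Ext)

lemma Ext_ins: "Ext M (ins a s) = insert a (Ext M s)"
  and mem_ins: "mem M z (ins a s) \<longleftrightarrow> z = a \<or> mem M z s"
  by (simp_all add: ins_def Ext_mk mem_mk small_insert small_Ext)

lemma cup_set: "is_set M (cup s t)"
  by (simp add: cup_def is_set_mk small_Un small_Ext)

lemma fin_atoms_mem: "fin_atoms s \<Longrightarrow> mem M a s \<Longrightarrow> a \<in> At"
  by (auto simp: fin_atoms_def)

lemma fin_atoms_zero: "fin_atoms zero"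
  by (simp add: fin_atoms_def fin_zero Ext_zero)

lemma fin_atoms_cup: "fin_atoms s \<Longrightarrow> fin_atoms t \<Longrightarrow> fin_atoms (cup s t)"
  by (simp add: fin_atoms_def Ext_cup) (simp add: cup_def fin_Un)

lemma fin_atoms_ins: "fin_atoms s \<Longrightarrow> a \<in> At \<Longrightarrow> fin_atoms (ins a s)"
  by (simp add: fin_atoms_def Ext_ins) (simp add: ins_def fin_insert)

lemma fin_atoms_act:
  assumes "\<pi> \<in> perms M" "fin_atoms s"
  shows "fin_atoms (act \<pi> s)"
  using assms perm_bij[OF assms(1)] unfolding fin_atoms_def bij_betw_def Ext_act[OF assms(1)]
  by (blast intro: fin_act)

lemma fix_antimono: "Ext M s \<subseteq> Ext M t \<Longrightarrow> \<pi> \<in> fix_group M t \<Longrightarrow> \<pi> \<in> fix_group M s"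
  by (auto simp: fix_iff subset_iff)

lemma supp_mono: "Ext M s \<subseteq> Ext M t \<Longrightarrow> supp s x \<Longrightarrow> supp t x"
  unfolding supp_def using fix_antimono by blast

lemma fix_comp:
  assumes "\<pi> \<in> fix_group M s" "\<rho> \<in> fix_group M s"
  obtains \<tau> where "\<tau> \<in> fix_group M s" "\<And>x. act \<tau> x = act \<pi> (act \<rho> x)"
proof -
  obtain \<tau> where "\<tau> \<in> perms M" "\<And>x. act \<tau> x = act \<pi> (act \<rho> x)"
    using ex_comp[OF fix_perms fix_perms] assms by metis
  then show thesis using that assms by (simp add: fix_iff)
qed

lemma fix_inv:
  assumes "\<pi> \<in> fix_group M s"
  obtains \<rho> where "\<rho> \<in> fix_group M s" "\<And>x. act \<rho> (act \<pi> x) = x" "\<And>x. act \<pi> (act \<rho> x) = x"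
proof -
  obtain \<rho> where \<rho>: "\<rho> \<in> perms M" "\<And>x. act \<rho> (act \<pi> x) = x" "\<And>x. act \<pi> (act \<rho> x) = x"
    using ex_inv[OF fix_perms[OF assms]] by metis
  have "act \<rho> a = a" if "mem M a s" for a
    using \<rho>(2)[of a] assms that by (simp add: fix_iff)
  then have "\<rho> \<in> fix_group M s" using \<rho>(1) by (simp add: fix_iff)
  then show thesis using that \<rho>(2,3) by blast
qed

lemma fix_swap:
  assumes "a \<in> At" "b \<in> At" "\<not> mem M a s" "\<not> mem M b s" "fin_atoms s"
  obtains \<tau> where "\<tau> \<in> fix_group M s" "act \<tau> a = b" "act \<tau> b = a"
    "\<And>c. c \<in> At \<Longrightarrow> c \<noteq> a \<Longrightarrow> c \<noteq> b \<Longrightarrow> act \<tau> c = c"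
proof -
  obtain \<tau> where \<tau>: "\<tau> \<in> perms M" "act \<tau> a = b" "act \<tau> b = a"
    "\<And>c. c \<in> At \<Longrightarrow> c \<noteq> a \<Longrightarrow> c \<noteq> b \<Longrightarrow> act \<tau> c = c"
    using ex_swap[OF assms(1,2)] by metis
  have "act \<tau> c = c" if "mem M c s" for c
    using \<tau>(4)[OF fin_atoms_mem[OF assms(5) that]] assms(3,4) that by blast
  then have "\<tau> \<in> fix_group M s" using \<tau>(1) by (simp add: fix_iff)
  then show thesis using that \<tau> by blast
qed

text \<open>For \<open>\<rho>\<close> fixing \<open>act \<pi> s\<close> pointwise, the conjugate of
  \<open>\<rho>\<close> by \<open>\<pi>\<close> fixes \<open>s\<close> pointwise and therefore fixes
  \<open>x\<close>.\<close>

lemma supp_act: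
  assumes "\<pi> \<in> perms M" "supp s x"
  shows "supp (act \<pi> s) (act \<pi> x)"
  unfolding supp_def
proof
  fix \<rho> assume \<rho>: "\<rho> \<in> fix_group M (act \<pi> s)"
  obtain \<pi>' where \<pi>': "\<pi>' \<in> perms M" "\<And>x. act \<pi>' (act \<pi> x) = x" "\<And>x. act \<pi> (act \<pi>' x) = x"
    using ex_inv[OF assms(1)] by metis
  obtain \<sigma> where \<sigma>: "\<sigma> \<in> perms M" "\<And>x. act \<sigma> x = act \<rho> (act \<pi> x)"
    using ex_comp[OF fix_perms[OF \<rho>] assms(1)] by metis
  obtain \<tau> where \<tau>: "\<tau> \<in> perms M" "\<And>x. act \<tau> x = act \<pi>' (act \<sigma> x)"
    using ex_comp[OF \<pi>'(1) \<sigma>(1)] by metis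
  have "act \<tau> a = a" if "mem M a s" for a
    using \<rho> that mem_act[OF assms(1)] by (simp add: \<tau>(2) \<sigma>(2) fix_iff \<pi>'(2))
  then have "act \<tau> x = x" using assms(2) \<tau>(1) by (simp add: supp_def fix_iff)
  then have "act \<pi> (act \<pi>' (act \<rho> (act \<pi> x))) = act \<pi> x" by (simp add: \<tau>(2) \<sigma>(2))
  then show "act \<rho> (act \<pi> x) = act \<pi> x" by (simp add: \<pi>'(3))
qed

text \<open>One inclusion suffices: applying it to the inverse of \<open>\<pi>\<close>, which also
  fixes \<open>s\<close> pointwise, gives the other.\<close>

lemma suppI:
  assumes "is_set M x" "\<And>\<pi> z. \<pi> \<in> fix_group M s \<Longrightarrow> mem M z x \<Longrightarrow> mem M (act \<pi> z) x"
  shows "supp s x"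
  unfolding supp_def
proof
  fix \<pi> assume \<pi>: "\<pi> \<in> fix_group M s"
  note p = fix_perms[OF \<pi>]
  obtain \<rho> where \<rho>: "\<rho> \<in> fix_group M s" "\<And>x. act \<pi> (act \<rho> x) = x" using fix_inv[OF \<pi>] by metis
  show "act \<pi> x = x"
  proof (rule set_ext)
    fix z
    show "mem M z (act \<pi> x) \<longleftrightarrow> mem M z x"
      using assms(2)[OF \<pi>, of "act \<rho> z"] assms(2)[OF \<rho>(1), of z] mem_act[OF p, of "act \<rho> z" x] \<rho>(2)
      by auto
  qed (simp_all add: is_set_act p assms(1))
qed

lemma supp_elems: "is_set M x \<Longrightarrow> (\<And>z. mem M z x \<Longrightarrow> supp s z) \<Longrightarrow> supp s x"
  by (rule suppI) (auto simp: supp_def)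

lemma supp_pr: "supp s x \<Longrightarrow> supp s y \<Longrightarrow> supp s (pr x y)"
  by (simp add: supp_def act_pr fix_perms)

lemma supp_mem:
  assumes "supp s x" "\<pi> \<in> fix_group M s"
  shows "mem M (act \<pi> z) x \<longleftrightarrow> mem M z x"
  using mem_act[OF fix_perms[OF assms(2)], of z x] assms by (simp add: supp_def)

lemma supp_om: "k \<in> om \<Longrightarrow> supp s k"
  by (simp add: supp_def act_om fix_perms)

text \<open>Add the atoms of \<open>t\<close> to \<open>u\<close> one at a time: \<open>a\<close> is the one at which
  the set starts to support \<open>x\<close>.\<close>

lemma supp_last_atom:
  assumes u: "fin_atoms u" and t: "fin_atoms t" and x: "supp t x" "\<not> supp u x"
  obtains w a where "fin_atoms w" "Ext M u \<subseteq> Ext M w" "a \<in> At" "\<not> mem M a w" "supp (ins a w) x" "\<not> supp w x"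
proof -
  \<comment> \<open>The goal \<open>C\<close> does not involve the induction variable and enters the
    formula as a constant truth value. Only \<open>supp w x\<close> has to be written definably, by
    way of \<open>perm_app\<close>.\<close>
  define C where "C \<longleftrightarrow> (\<exists>w a. fin_atoms w \<and> Ext M u \<subseteq> Ext M w \<and> a \<in> At \<and> \<not> mem M a w \<and>
    supp (ins a w) x \<and> \<not> supp w x)"
  have supp_iff: "(\<forall>\<pi>. \<pi> \<in> fix_group M w \<longrightarrow> perm_app M \<pi> x x) \<longleftrightarrow> supp w x" for w
    using perm_app_iff fix_perms by (auto simp: supp_def eq_commute)
  have "fin t" using t by (simp add: fin_atoms_def)
  then have "\<forall>w. is_set M w \<longrightarrow> (\<forall>z. mem M z w \<longleftrightarrow> mem M z u \<or> mem M z t) \<longrightarrow>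
    (\<forall>\<pi>. \<pi> \<in> fix_group M w \<longrightarrow> perm_app M \<pi> x x) \<longrightarrow> C"
  proof (induct rule: fin_induct)
    case definable show ?case by (intro definable_intros)
  next
    case zero
    have "w = u" if "is_set M w" "\<forall>z. mem M z w \<longleftrightarrow> mem M z u \<or> mem M z zero" for w
      using that u set_ext[of w u] by (simp add: fin_atoms_def fin_set not_mem_zero)
    then show ?case using x(2) unfolding supp_iff by blast
  next
    case (insert y a)
    have "fin y" using \<open>fin t\<close> insert(1,2) by (rule fin_subset)
    then have y: "fin_atoms y" using subset_trans[OF insert(2)] t by (simp add: fin_atoms_def)
    have IH: "C" if "supp (cup u y) x"
      using insert(3) that unfolding supp_iff
      by (elim allE[of _ "cup u y"]) (simp add: mem_cup cup_set)
    show ?case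
      unfolding supp_iff
    proof (intro allI impI)
      fix w
      assume w: "is_set M w" "\<forall>z. mem M z w \<longleftrightarrow> mem M z u \<or> mem M z (mk (insert a (Ext M y)))"
        and wx: "supp w x"
      have "w = ins a (cup u y)"
        by (rule set_ext)
          (use w in \<open>auto simp: ins_def is_set_mk mem_mk mem_cup small_insert small_Ext\<close>)
      then have *: "supp (ins a (cup u y)) x" using wx by simp
      show C
      proof (cases "supp (cup u y) x")
        case False
        then have "\<not> mem M a (cup u y)" using * supp_mono[of "ins a (cup u y)" "cup u y"]
          by (auto simp: Ext_ins)
        moreover have "a \<in> At" using insert(4) t fin_atoms_mem by blast
        moreover have "Ext M u \<subseteq> Ext M (cup u y)" by (simp add: Ext_cup)
        ultimately show ?thesis unfolding C_def using * False fin_atoms_cup[OF u y] by blast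
      qed (rule IH)
    qed
  qed
  moreover have "supp (cup u t) x" using supp_mono[OF _ x(1)] by (simp add: Ext_cup)
  ultimately have C
    unfolding supp_iff by (elim allE[of _ "cup u t"]) (simp add: mem_cup cup_set)
  then show thesis using that unfolding C_def by blast
qed

text \<open>If some \<open>\<sigma>\<close> fixing \<open>w\<close> fixes \<open>x\<close> but moves \<open>a\<close>, then composing
  it with transpositions of atoms outside \<open>w \<union> {a}\<close> gives permutations fixing \<open>x\<close> and
  sending \<open>a\<close> anywhere outside \<open>w\<close>, so that already \<open>w\<close> supports \<open>x\<close>.\<close>

lemma act_eq_iff_last_atom:
  assumes w: "fin_atoms w" and a: "a \<in> At" "\<not> mem M a w" and x: "supp (ins a w) x" "\<not> supp w x"
    and \<pi>: "\<pi> \<in> fix_group M w" and \<rho>: "\<rho> \<in> fix_group M w"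
  shows "act \<pi> x = act \<rho> x \<longleftrightarrow> act \<pi> a = act \<rho> a"
proof -
  have 1: "act \<tau> x = x" if "\<tau> \<in> fix_group M w" "act \<tau> a = a" for \<tau>
    using that x(1) by (auto simp: supp_def fix_iff mem_ins)
  have At: "act \<tau> a \<in> At" "\<not> mem M (act \<tau> a) w" if \<tau>: "\<tau> \<in> fix_group M w" for \<tau>
  proof -
    show "act \<tau> a \<in> At" using bij_betw_apply[OF perm_bij[OF fix_perms[OF \<tau>]] a(1)] .
    show "\<not> mem M (act \<tau> a) w"
    proof
      assume "mem M (act \<tau> a) w"
      then have "act \<tau> (act \<tau> a) = act \<tau> a" using \<tau> by (simp add: fix_iff)
      then show False using act_inject[OF fix_perms[OF \<tau>]] a(2) \<open>mem M (act \<tau> a) w\<close> by simp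
    qed
  qed
  have 2: "act \<sigma> a = a" if \<sigma>: "\<sigma> \<in> fix_group M w" and \<sigma>x: "act \<sigma> x = x" for \<sigma>
  proof (rule ccontr)
    assume b: "act \<sigma> a \<noteq> a"
    have "act \<tau> x = x" if \<tau>: "\<tau> \<in> fix_group M w" for \<tau>
    proof -
      have "\<exists>\<eta>\<in>fix_group M w. act \<eta> x = x \<and> act \<eta> a = act \<tau> a"
      proof (cases "act \<tau> a = a \<or> act \<tau> a = act \<sigma> a")
        case True
        \<comment> \<open>\<open>\<tau>\<close> itself serves if it fixes \<open>a\<close>, and
          \<open>\<sigma>\<close> serves if the two agree at \<open>a\<close>.\<close>
        then show ?thesis using 1[OF \<tau>] \<tau> \<sigma> \<sigma>x by metis
      next
        case False
        obtain s where s: "s \<in> fix_group M w" "act s (act \<sigma> a) = act \<tau> a"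
          "\<And>c. c \<in> At \<Longrightarrow> c \<noteq> act \<sigma> a \<Longrightarrow> c \<noteq> act \<tau> a \<Longrightarrow> act s c = c"
          using fix_swap[OF At(1)[OF \<sigma>] At(1)[OF \<tau>] At(2)[OF \<sigma>] At(2)[OF \<tau>] w] by metis
        have "act s a = a" using s(3)[OF a(1)] False b by metis
        then have "act s x = x" using 1[OF s(1)] by blast
        moreover obtain \<eta> where "\<eta> \<in> fix_group M w" "\<And>z. act \<eta> z = act s (act \<sigma> z)"
          using fix_comp[OF s(1) \<sigma>] by metis
        ultimately show ?thesis using s(2) \<sigma>x by metis
      qed
      then obtain \<eta> where \<eta>: "\<eta> \<in> fix_group M w" "act \<eta> x = x" "act \<eta> a = act \<tau> a" by blast
      obtain \<eta>' where \<eta>': "\<eta>' \<in> fix_group M w" "\<And>z. act \<eta>' (act \<eta> z) = z" "\<And>z. act \<eta> (act \<eta>' z) = z"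
        using fix_inv[OF \<eta>(1)] by metis
      \<comment> \<open>\<open>\<theta>\<close> is the inverse of \<open>\<eta>\<close> after
        \<open>\<tau>\<close>. It fixes \<open>a\<close>, hence \<open>x\<close>, so
        \<open>\<tau>\<close> and \<open>\<eta>\<close> agree at \<open>x\<close>.\<close>
      obtain \<theta> where \<theta>: "\<theta> \<in> fix_group M w" "\<And>z. act \<theta> z = act \<eta>' (act \<tau> z)"
        using fix_comp[OF \<eta>'(1) \<tau>] by metis
      have "act \<theta> x = x" using 1[OF \<theta>(1)] \<theta>(2) \<eta>(3) \<eta>'(2) by metis
      then show ?thesis using \<theta>(2) \<eta>(2) \<eta>'(3) by metis
    qed
    then show False using x(2) by (simp add: supp_def)
  qed
  \<comment> \<open>Facts 1 and 2 say that an element of the stabilizer of \<open>w\<close> fixes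
    \<open>x\<close> iff it fixes \<open>a\<close>. Apply this to the inverse of
    \<open>\<rho>\<close> after \<open>\<pi>\<close>.\<close>
  obtain \<rho>' where \<rho>': "\<rho>' \<in> fix_group M w" "\<And>z. act \<rho>' (act \<rho> z) = z" "\<And>z. act \<rho> (act \<rho>' z) = z"
    using fix_inv[OF \<rho>] by metis
  obtain \<theta> where \<theta>: "\<theta> \<in> fix_group M w" "\<And>z. act \<theta> z = act \<rho>' (act \<pi> z)"
    using fix_comp[OF \<rho>'(1) \<pi>] by metis
  show ?thesis using 1[OF \<theta>(1)] 2[OF \<theta>(1)] \<theta>(2) \<rho>'(2,3) by metis
qed


section \<open>The class of hereditarily symmetric elements\<close>

abbreviation D :: "'v set" where
  "D \<equiv> BFM M"

lemma trcl_self: "x \<in> trcl_sing M x"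
  by (simp add: trcl_sing_def)

lemma trcl_elem: "y \<in> trcl_sing M x \<Longrightarrow> mem M z y \<Longrightarrow> z \<in> trcl_sing M x"
  unfolding trcl_sing_def transitive_set_iff by blast

lemma trcl_subset: "mem M y x \<Longrightarrow> trcl_sing M y \<subseteq> trcl_sing M x"
  unfolding trcl_sing_def transitive_set_iff by blast

text \<open>Inside any transitive set containing \<open>x\<close>, the elements satisfying the
  right-hand side form a transitive set containing \<open>x\<close>.\<close>

lemma trcl_cases:
  assumes "z \<in> trcl_sing M x"
  shows "z = x \<or> (\<exists>y. mem M y x \<and> z \<in> trcl_sing M y)"
proof -
  obtain t where t: "transitive_set M t" "mem M x t" using ex_transitive_set by blast
  let ?S = "{w. mem M w t \<and> (w = x \<or> (\<exists>y. mem M y x \<and> w \<in> trcl_sing M y))}"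
  have S: "small ?S" by (rule small_sep) (intro definable_intros)
  have "mem M w t" if "mem M v t" "mem M w v" for v w
    using t(1) that unfolding transitive_set_iff by blast
  then have "w \<in> ?S" if "v \<in> ?S" "mem M w v" for v w
    using that trcl_self[of w] trcl_elem[of v _ w] by blast
  then have "transitive_set M (mk ?S)"
    unfolding transitive_set_iff mem_mk[OF S] using is_set_mk[OF S] by blast
  moreover have "mem M x (mk ?S)" using t(2) by (simp add: mem_mk[OF S])
  ultimately have "mem M z (mk ?S)" using assms unfolding trcl_sing_def by blast
  then show ?thesis by (simp add: mem_mk[OF S])
qed

section \<open>Closure properties of the class\<close>

lemma D_symmetric: "x \<in> D \<Longrightarrow> symmetric M x"
  using trcl_self by (simp add: BFM_def)

lemma D_supp: "x \<in> D \<Longrightarrow> \<exists>s. fin_atoms s \<and> supp s x"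
  using D_symmetric symmetric_iff by blast

lemma D_mem: "x \<in> D \<Longrightarrow> mem M y x \<Longrightarrow> y \<in> D"
  using trcl_subset by (auto simp: BFM_def)

lemma D_I: "fin_atoms s \<Longrightarrow> supp s x \<Longrightarrow> (\<And>y. mem M y x \<Longrightarrow> y \<in> D) \<Longrightarrow> x \<in> D"
  using trcl_cases[of _ x] symmetric_iff[of x] unfolding BFM_def by blast

lemma D_elems:
  "fin_atoms s \<Longrightarrow> is_set M x \<Longrightarrow> (\<And>y. mem M y x \<Longrightarrow> y \<in> D \<and> supp s y) \<Longrightarrow> x \<in> D"
  by (rule D_I[of s]) (auto intro: supp_elems)

text \<open>The inverse \<open>\<rho>\<close> carries the transitive closure of
  \<open>act \<pi> x\<close> into that of \<open>x\<close>, and supports found there are carried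
  back by \<open>\<pi>\<close>.\<close>

lemma D_act:
  assumes "\<pi> \<in> perms M" "x \<in> D"
  shows "act \<pi> x \<in> D"
proof -
  obtain \<rho> where \<rho>: "\<rho> \<in> perms M" "\<And>x. act \<rho> (act \<pi> x) = x" "\<And>x. act \<pi> (act \<rho> x) = x"
    using ex_inv[OF assms(1)] by metis
  have "symmetric M z" if z: "z \<in> trcl_sing M (act \<pi> x)" for z
  proof -
    have "act \<rho> z \<in> trcl_sing M x"
      unfolding trcl_sing_def
    proof (intro CollectI allI impI)
      fix t assume "transitive_set M t \<and> mem M x t"
      then have "transitive_set M (act \<pi> t)" "mem M (act \<pi> x) (act \<pi> t)"
        using transitive_set_act mem_act assms(1) by auto
      then have "mem M z (act \<pi> t)" using z by (simp add: trcl_sing_def)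
      then show "mem M (act \<rho> z) t" using mem_act[OF \<rho>(1), of z "act \<pi> t"] \<rho>(2) by simp
    qed
    then have "symmetric M (act \<rho> z)" using assms(2) by (simp add: BFM_def)
    then obtain s where "fin_atoms s" "supp s (act \<rho> z)" using symmetric_iff by blast
    then have "fin_atoms (act \<pi> s)" "supp (act \<pi> s) z"
      using fin_atoms_act[OF assms(1)] supp_act[OF assms(1), of s "act \<rho> z"] \<rho>(3) by auto
    then show ?thesis using symmetric_iff by blast
  qed
  then show ?thesis by (simp add: BFM_def)
qed

lemma D_doubleton:
  assumes "x \<in> D" "y \<in> D"
  shows "mk {x, y} \<in> D"
proof -
  obtain s t where s: "fin_atoms s" "supp s x" and t: "fin_atoms t" "supp t y" using D_supp assms by metis
  then have "supp (cup s t) x" "supp (cup s t) y" using supp_mono[of s] supp_mono[of t]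
    by (simp_all add: Ext_cup)
  then show ?thesis
    using D_elems[OF fin_atoms_cup[OF s(1) t(1)], of "mk {x, y}"] assms
    by (auto simp: is_set_mk mem_mk small_insert2)
qed

lemma D_pr: "x \<in> D \<Longrightarrow> y \<in> D \<Longrightarrow> pr x y \<in> D"
  using D_doubleton[of x x] D_doubleton[of x y] D_doubleton[of "mk {x}" "mk {x, y}"]
  by (simp add: pr_def)

text \<open>\<open>om\<close> is transitive, so all elements in the transitive closure of
  \<open>k\<close> are natural numbers, which every permutation fixes.\<close>

lemma D_om: "k \<in> om \<Longrightarrow> k \<in> D"
proof -
  assume k: "k \<in> om"
  have "transitive_set M (mk om)"
    unfolding transitive_set_iff using om_mem_om is_set_mk[OF small_om] mem_mk[OF small_om] by auto
  then have "z \<in> om" if "z \<in> trcl_sing M k" for z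
    using that k unfolding trcl_sing_def mem_mk[OF small_om, symmetric] by blast
  then have "symmetric M z" if "z \<in> trcl_sing M k" for z
    using that symmetric_iff supp_om fin_atoms_zero by blast
  then show ?thesis by (simp add: BFM_def)
qed

lemma D_mk_om: "mk om \<in> D"
  by (rule D_elems[OF fin_atoms_zero]) (auto simp: is_set_mk mem_mk small_om D_om supp_om)


subsection \<open>Absoluteness\<close>

text \<open>\<open>D\<close> is transitive, so its elements lose no members when
  relativised.\<close>

lemma ext_D: "x \<in> D \<Longrightarrow> ext M D x = Ext M x"
  using D_mem by (auto simp: ext_def)

lemma is_pair_D: "p \<in> D \<Longrightarrow> is_pair M D p x y \<longleftrightarrow> p = pr x y"
proof -
  assume p: "p \<in> D"
  have "is_pair M D p x y \<longleftrightarrow> (\<exists>s\<in>D. \<exists>t\<in>D. Ext M s = {x} \<and> Ext M t = {x, y} \<and> Ext M p = {s, t})"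
    unfolding is_pair_def by (intro bex_cong refl) (simp add: ext_D p)
  also have "\<dots> \<longleftrightarrow> is_pair M UNIV p x y"
  proof
    assume "is_pair M UNIV p x y"
    then obtain s t where st: "Ext M s = {x}" "Ext M t = {x, y}" "Ext M p = {s, t}"
      unfolding is_pair_def by blast
    then have "s \<in> Ext M p" "t \<in> Ext M p" by simp_all
    then have "s \<in> D" "t \<in> D" using D_mem[OF p] by simp_all
    then show "\<exists>s\<in>D. \<exists>t\<in>D. Ext M s = {x} \<and> Ext M t = {x, y} \<and> Ext M p = {s, t}"
      using st by blast
  qed (auto simp: is_pair_def)
  finally show ?thesis by (simp add: is_pair_iff)
qed

lemma mp_D: "f \<in> D \<Longrightarrow> maps_to M D f x y \<longleftrightarrow> mp f x y"
  unfolding maps_to_def ext_D using D_mem by (intro bex_cong refl) (simp add: is_pair_D is_pair_iff)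

lemma is_fun_D: "f \<in> D \<Longrightarrow> is_fun M D f X Y \<longleftrightarrow> is_fun M UNIV f X Y"
proof -
  assume f: "f \<in> D"
  have "(\<forall>p\<in>ext M D f. \<exists>x\<in>X. \<exists>y\<in>Y. is_pair M D p x y) \<longleftrightarrow>
    (\<forall>p\<in>Ext M f. \<exists>x\<in>X. \<exists>y\<in>Y. is_pair M UNIV p x y)"
    unfolding ext_D[OF f] using D_mem[OF f] by (intro ball_cong refl) (simp add: is_pair_D is_pair_iff)
  then show ?thesis unfolding is_fun_def mp_D[OF f] by blast
qed

lemma is_bij_D: "f \<in> D \<Longrightarrow> is_bij M D f X Y \<longleftrightarrow> is_bij M UNIV f X Y"
  unfolding is_bij_def by (simp add: is_fun_D mp_D)

lemma has_card_D: "x \<in> D \<Longrightarrow> n \<in> D \<Longrightarrow> has_card M D x n \<longleftrightarrow>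
    is_set M x \<and> (\<exists>f\<in>D. is_bij M UNIV f (Ext M n) (Ext M x))"
  unfolding has_card_def by (simp add: ext_D is_bij_D cong: bex_cong)

lemma has_card_UNIV: "x \<in> D \<Longrightarrow> n \<in> D \<Longrightarrow> has_card M D x n \<Longrightarrow> has_card M UNIV x n"
  by (auto simp: has_card_D has_card_iff)

text \<open>The set \<open>mk om\<close> is inductive and belongs to \<open>D\<close>, so lying in
  all inductive sets of \<open>D\<close> already forces membership in \<open>om\<close>.\<close>

lemma omega_D: "omega M D = om"
proof -
  have ind: "is_inductive M D I \<longleftrightarrow> is_inductive M UNIV I" if I: "I \<in> D" for I
  proof -
    have "z \<in> D" if "z \<in> Ext M I" for z using D_mem[OF I] that by simp
    then show ?thesis unfolding is_inductive_def ext_D[OF I]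
      by (intro conj_cong ball_cong bex_cong refl) (simp_all add: ext_D)
  qed
  show ?thesis
  proof (intro set_eqI iffI)
    fix n assume n: "n \<in> omega M D"
    have "is_inductive M UNIV (mk om)"
      by (simp add: is_inductive_iff is_set_mk mem_mk small_om zero_om succ_om)
    then have "mem M n (mk om)" using n D_mk_om ind by (simp add: omega_def)
    then show "n \<in> om" by (simp add: mem_mk small_om)
  next
    fix n assume "n \<in> om"
    then show "n \<in> omega M D" using D_om ind by (auto simp: omega_def)
  qed
qed

section \<open>Finite sets in the class and supports of their elements\<close>

lemma bij_D:
  assumes "is_bij M UNIV f (Ext M m) (Ext M x)" "m \<in> om" "fin_atoms s"
    "\<And>y. mem M y x \<Longrightarrow> y \<in> D \<and> supp s y"
  shows "f \<in> D"
proof (rule D_elems[OF assms(3)])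
  note f = is_bij_fun[OF assms(1), unfolded is_fun_iff]
  show "is_set M f" using f by blast
  fix p assume "mem M p f"
  then obtain j y where "mem M j m" "mem M y x" "p = pr j y" using f by auto
  then show "p \<in> D \<and> supp s p"
    using assms(4) om_mem_om[OF assms(2)] D_pr D_om supp_pr supp_om by simp
qed

text \<open>A common support \<open>s\<close> of the elements of \<open>x\<close> also supports each
  pair of a bijection with a natural number, so a bijection found in \<open>M\<close> belongs to
  \<open>D\<close>.\<close>

lemma has_card_D_iff:
  assumes "m \<in> om" "fin_atoms s" "\<And>y. mem M y x \<Longrightarrow> y \<in> D \<and> supp s y"
  shows "has_card M D x m \<longleftrightarrow> has_card M UNIV x m"
proof (cases "is_set M x")
  case True
  then have "x \<in> D" by (rule D_elems[OF assms(2) _ assms(3)])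
  then show ?thesis
    using bij_D[OF _ assms] D_om[OF assms(1)] by (auto simp: has_card_D has_card_iff)
qed (simp add: has_card_def)

text \<open>A support of \<open>f\<close> works: if \<open>\<pi>\<close> fixes \<open>f\<close>, it
  fixes \<open>f k\<close> too, since it fixes the natural number \<open>k\<close>.\<close>

lemma bij_uniform_support:
  assumes "f \<in> D" "is_bij M UNIV f (Ext M m) (Ext M x)" "m \<in> om"
  shows "\<exists>v. fin_atoms v \<and> (\<forall>y. mem M y x \<longrightarrow> supp v y)"
proof -
  obtain v where v: "fin_atoms v" "supp v f" using D_supp[OF assms(1)] by blast
  have "act \<pi> y = y" if y: "mem M y x" and \<pi>: "\<pi> \<in> fix_group M v" for \<pi> y
  proof -
    obtain k where k: "mem M k m" "mp f k y" using is_bij_surj[OF assms(2), of y] y by auto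
    have "mp (act \<pi> f) (act \<pi> k) (act \<pi> y)" using k(2) mp_act fix_perms[OF \<pi>] by blast
    then have "mp f k (act \<pi> y)"
      using v(2) \<pi> act_om[OF fix_perms[OF \<pi>] om_mem_om[OF assms(3) k(1)]] by (simp add: supp_def)
    then show ?thesis using is_fun_fun[OF is_bij_fun[OF assms(2)]] k(2) by blast
  qed
  then show ?thesis using v(1) unfolding supp_def by blast
qed

lemma has_card_uniform_support:
  assumes "x \<in> D" "m \<in> om" "has_card M D x m"
  shows "\<exists>v. fin_atoms v \<and> (\<forall>y. mem M y x \<longrightarrow> supp v y)"
  using assms bij_uniform_support by (auto simp: has_card_D D_om)

lemma has_card_act:
  assumes "\<pi> \<in> perms M" "x \<in> D" "m \<in> om" "has_card M D x m"
  shows "has_card M D (act \<pi> x) m"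
proof -
  obtain f where f: "f \<in> D" "is_bij M UNIV f (Ext M m) (Ext M x)" "is_set M x"
    using assms by (auto simp: has_card_D D_om)
  have "act \<pi> ` Ext M m = Ext M m" using act_om[OF assms(1,3)] Ext_act[OF assms(1), of m] by simp
  then have "is_bij M UNIV (act \<pi> f) (Ext M m) (Ext M (act \<pi> x))"
    using is_bij_act[OF assms(1) f(2)] by (simp add: Ext_act assms(1))
  then show ?thesis
    using D_act[OF assms(1)] f assms(2,3) is_set_act[OF assms(1)] by (auto simp: has_card_D D_om)
qed

text \<open>Take the image of \<open>n\<close> under a bijection from \<open>m\<close>; as
  \<open>m\<close> is transitive, \<open>n\<close> is included in it.\<close>

lemma ex_subset_card:
  assumes "has_card M UNIV x m" "m \<in> om" "mem M n m"
  shows "\<exists>y. is_set M y \<and> Ext M y \<subseteq> Ext M x \<and> has_card M UNIV y n"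
proof -
  obtain f where f: "is_bij M UNIV f (Ext M m) (Ext M x)" using assms(1) has_card_iff by blast
  have nm: "mem M j m" if "mem M j n" for j using om_trans[OF assms(2,3) that] .
  let ?Y = "{w. mem M w x \<and> (\<exists>j. mem M j n \<and> mp f j w)}"
  have Y: "small ?Y" by (rule small_sep) (intro definable_intros)
  have d: "definable M (\<lambda>e. mp f (e 0) (e 1))" by (intro definable_intros)
  obtain g where g: "is_set M g" "\<And>p. mem M p g \<longleftrightarrow> (\<exists>j\<in>Ext M n. \<exists>w\<in>?Y. mp f j w \<and> p = pr j w)"
    "\<And>j w. mp g j w \<longleftrightarrow> j \<in> Ext M n \<and> w \<in> ?Y \<and> mp f j w"
    by (rule obtain_rel[OF small_Ext[of n] Y d]) (rule that)
  have "is_bij M UNIV g (Ext M n) (Ext M (mk ?Y))"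
  proof (rule is_bijI)
    show "\<exists>j\<in>Ext M n. \<exists>w\<in>Ext M (mk ?Y). p = pr j w" if "mem M p g" for p
      using that unfolding g(2) Ext_mk[OF Y] by blast
    show "\<exists>w. mp g j w" if "j \<in> Ext M n" for j
      using is_fun_total[OF is_bij_fun[OF f], of j] nm that unfolding g(3) by auto
    show "\<exists>j. mp g j w" if "w \<in> Ext M (mk ?Y)" for w
      using that unfolding g(3) Ext_mk[OF Y] by auto
    show "w = w'" if "mp g j w" "mp g j w'" for j w w'
      using that is_fun_fun[OF is_bij_fun[OF f]] unfolding g(3) by blast
    show "j = j'" if "mp g j w" "mp g j' w" for j j' w
      using that is_bij_inj[OF f] unfolding g(3) by blast
  qed (rule g(1))
  then have "has_card M UNIV (mk ?Y) n" unfolding has_card_iff using is_set_mk[OF Y] by blast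
  moreover have "Ext M (mk ?Y) \<subseteq> Ext M x" by (auto simp: Ext_mk[OF Y])
  ultimately show ?thesis using is_set_mk[OF Y] by blast
qed

end


section \<open>The choice principles in the model\<close>

locale infinite_atoms = zfa_model +
  assumes atoms_infinite: "\<not> finite_set M UNIV (atoms M)"
begin

section \<open>Fresh atoms and infinite sets in the class\<close>

lemma fresh_atom:
  assumes "fin_atoms s"
  obtains a where "a \<in> At" "\<not> mem M a s"
proof -
  have "\<not> At \<subseteq> Ext M s"
    using fin_subset[of s "atoms M"] assms atoms_infinite atoms_is_set by (auto simp: fin_atoms_def)
  then show thesis using that by (auto simp: subset_iff)
qed

text \<open>Move \<open>a\<close> to a fresh atom \<open>b\<close>; the transposition of \<open>b\<close> with another fresh
  atom fixes \<open>v\<close> but moves \<open>\<pi> x\<close>.\<close>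

lemma unsupported_translate:
  assumes w: "fin_atoms w" and a: "a \<in> At" "\<not> mem M a w" and x: "supp (ins a w) x" "\<not> supp w x"
    and v: "fin_atoms v"
  obtains \<pi> where "\<pi> \<in> fix_group M w" "\<not> supp v (act \<pi> x)"
proof -
  obtain b where b: "b \<in> At" "\<not> mem M b (cup v w)" using fresh_atom[OF fin_atoms_cup[OF v w]] by blast
  obtain c where c: "c \<in> At" "\<not> mem M c (ins b (cup v w))"
    using fresh_atom[OF fin_atoms_ins[OF fin_atoms_cup[OF v w] b(1)]] by blast
  have bc: "\<not> mem M b v" "\<not> mem M b w" "\<not> mem M c v" "\<not> mem M c w" "c \<noteq> b"
    using b(2) c(2) by (simp_all add: mem_ins mem_cup)
  obtain \<pi> where \<pi>: "\<pi> \<in> fix_group M w" "act \<pi> a = b"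
    using fix_swap[OF a(1) b(1) a(2) bc(2) w] by metis
  obtain \<sigma> where \<sigma>: "\<sigma> \<in> fix_group M (cup v w)" "act \<sigma> b = c"
    using fix_swap[OF b(1) c(1) b(2) _ fin_atoms_cup[OF v w]] bc by (metis mem_cup)
  have \<sigma>v: "\<sigma> \<in> fix_group M v" and \<sigma>w: "\<sigma> \<in> fix_group M w"
    using \<sigma>(1) by (simp_all add: fix_iff mem_cup)
  obtain \<tau> where \<tau>: "\<tau> \<in> fix_group M w" "\<And>z. act \<tau> z = act \<sigma> (act \<pi> z)"
    using fix_comp[OF \<sigma>w \<pi>(1)] by metis
  have "act \<tau> a \<noteq> act \<pi> a" using \<tau>(2) \<pi>(2) \<sigma>(2) bc(5) by simp
  then have "act \<tau> x \<noteq> act \<pi> x" using act_eq_iff_last_atom[OF w a x \<tau>(1) \<pi>(1)] by blast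
  then have "\<not> supp v (act \<pi> x)" using \<tau>(2) \<sigma>v by (auto simp: supp_def)
  then show thesis using that \<pi>(1) by blast
qed

text \<open>If \<open>u\<close> did not support \<open>x\<close>, some translate of \<open>x\<close>
  by a permutation fixing \<open>w\<close>, which includes \<open>u\<close>, would not be supported
  by \<open>v\<close>. That translate still belongs to \<open>X\<close>, as \<open>u\<close>
  supports \<open>X\<close>.\<close>

lemma supp_elem_of_uniformly_supported:
  assumes "fin_atoms u" "supp u X" "fin_atoms v" "\<And>x. mem M x X \<Longrightarrow> supp v x" "mem M x X"
  shows "supp u x"
proof (rule ccontr)
  assume "\<not> supp u x"
  then obtain w a where w: "fin_atoms w" "Ext M u \<subseteq> Ext M w" "a \<in> At" "\<not> mem M a w"
    "supp (ins a w) x" "\<not> supp w x"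
    using supp_last_atom[OF assms(1,3) assms(4)[OF assms(5)]] by metis
  obtain \<pi> where \<pi>: "\<pi> \<in> fix_group M w" "\<not> supp v (act \<pi> x)"
    using unsupported_translate[OF w(1,3-6) assms(3)] by metis
  have "mem M (act \<pi> x) X"
    using supp_mem[OF assms(2) fix_antimono[OF w(2) \<pi>(1)]] assms(5) by blast
  then show False using assms(4) \<pi>(2) by blast
qed

text \<open>The elements of a set that is finite in \<open>D\<close> have a common finite support,
  so it is enough to refute every candidate \<open>v\<close> for one.\<close>

lemma infinite_D_I:
  assumes "x \<in> D" "is_set M x" "\<And>v. fin_atoms v \<Longrightarrow> \<exists>y. mem M y x \<and> \<not> supp v y"
  shows "infinite_set M D x"
  using assms has_card_uniform_support[OF assms(1)]
  unfolding infinite_set_def finite_set_def omega_D by blast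

lemma atom_supp: "mem M a s \<Longrightarrow> supp s a"
  by (simp add: supp_def fix_iff)

lemma atom_D: "a \<in> At \<Longrightarrow> a \<in> D"
  by (rule D_I[OF fin_atoms_ins[OF fin_atoms_zero]]) (auto simp: atom_supp mem_ins dest: atom_empty)

lemma has_card_D_fin_atoms:
  assumes "fin_atoms z" "m \<in> om"
  shows "has_card M D z m \<longleftrightarrow> has_card M UNIV z m"
  by (rule has_card_D_iff[OF assms(2,1)]) (use fin_atoms_mem[OF assms(1)] atom_D atom_supp in blast)

lemma fin_atoms_D: "fin_atoms z \<Longrightarrow> z \<in> D"
  by (rule D_elems) (auto simp: fin_atoms_def fin_set atom_D atom_supp subset_iff)

lemma atoms_D: "atoms M \<in> D"
proof (rule D_I[OF fin_atoms_zero])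
  show "supp zero (atoms M)"
    using bij_betw_apply[OF perm_bij] by (intro suppI atoms_is_set) (auto dest!: fix_perms)
qed (simp add: atom_D)

lemma atoms_infinite_D: "infinite_set M D (atoms M)"
proof (rule infinite_D_I[OF atoms_D atoms_is_set])
  fix v assume v: "fin_atoms v"
  obtain b where b: "b \<in> At" "\<not> mem M b v" using fresh_atom[OF v] by blast
  obtain c where c: "c \<in> At" "\<not> mem M c (ins b v)" using fresh_atom[OF fin_atoms_ins[OF v b(1)]] by blast
  have "\<not> mem M c v" "c \<noteq> b" using c(2) by (simp_all add: mem_ins)
  then obtain \<tau> where "\<tau> \<in> fix_group M v" "act \<tau> b = c"
    using fix_swap[OF b(1) c(1) b(2) _ v] by metis
  then show "\<exists>y. mem M y (atoms M) \<and> \<not> supp v y"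
    using b(1) \<open>c \<noteq> b\<close> by (auto simp: supp_def)
qed

section \<open>Failure of selection on sets of atoms\<close>

lemma ex_finite_subset_avoiding:
  assumes "\<not> fin y" "is_set M y" "fin s" "k \<in> om"
  shows "\<exists>z. (\<forall>w. mem M w z \<longrightarrow> mem M w y \<and> \<not> mem M w s) \<and> has_card M UNIV z k"
  using assms(4)
proof (induct rule: om_induct)
  case definable show ?case by (intro definable_intros)
next
  case zero show ?case using has_card_zero not_mem_zero by blast
next
  case (succ k)
  then obtain z where z: "\<And>w. mem M w z \<Longrightarrow> mem M w y \<and> \<not> mem M w s" "has_card M UNIV z k" by blast
  then have "fin z" using succ(1) unfolding finite_set_def by blast
  then have "fin (cup z s)" using fin_Un assms(3) by (simp add: cup_def)
  \<comment> \<open>The finite set \<open>cup z s\<close> cannot cover \<open>y\<close>, so there is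
    a further point avoiding both \<open>z\<close> and \<open>s\<close>.\<close>
  then have "\<not> Ext M y \<subseteq> Ext M (cup z s)" using fin_subset assms(1,2) by blast
  then obtain w where w: "mem M w y" "\<not> mem M w z" "\<not> mem M w s" by (auto simp: Ext_cup subset_iff)
  show ?case
    using has_card_succ[OF z(2) w(2)] z(1) w
    by (intro exI[of _ "mk (insert w (Ext M z))"]) (auto simp: mem_mk small_insert small_Ext)
qed

lemma not_nRC_fin:
  assumes n: "n \<in> om" "n \<noteq> zero"
  shows "\<not> nRC_fin M D n"
proof
  assume "nRC_fin M D n"
  then obtain y f where y: "y \<in> D" "subset_of M D y (atoms M)" "infinite_set M D y" and f: "f \<in> D"
    and fn: "is_fun M D f (subsets_gt M D (ext M D y) n) (subsets_eq M D (ext M D y) n)"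
    and sub: "\<And>z w. z \<in> subsets_gt M D (ext M D y) n \<Longrightarrow> w \<in> D \<Longrightarrow> maps_to M D f z w \<Longrightarrow> subset_of M D w z"
    using atoms_D atoms_infinite_D unfolding nRC_fin_def by blast
  note fn' = fn[unfolded is_fun_D[OF f]]
  have yA: "is_set M y" "Ext M y \<subseteq> At"
    using y(1,2) by (simp_all add: subset_of_def ext_D atoms_D)
  \<comment> \<open>Infinity in \<open>D\<close> is transferred to \<open>M\<close>: for finite sets
    of atoms, cardinalities in \<open>D\<close> and in \<open>M\<close> agree.\<close>
  have "\<not> fin y"
  proof
    assume "fin y"
    then have "fin_atoms y" using yA by (simp add: fin_atoms_def)
    then show False
      using \<open>fin y\<close> y(3) has_card_D_fin_atoms
      unfolding infinite_set_def finite_set_def omega_D by blast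
  qed
  obtain s where s: "fin_atoms s" "supp s f" using D_supp[OF f] by blast
  then obtain z where z: "\<And>w. mem M w z \<Longrightarrow> mem M w y \<and> \<not> mem M w s" "has_card M UNIV z (succ n)"
    using ex_finite_subset_avoiding[OF \<open>\<not> fin y\<close> yA(1) _ succ_om[OF n(1)], of s] unfolding fin_atoms_def by blast
  have zset: "is_set M z" and "fin z"
    using z(2) succ_om[OF n(1)] unfolding finite_set_def has_card_def by blast+
  then have faz: "fin_atoms z" using z(1) yA(2) by (auto simp: fin_atoms_def)
  have "has_card M D z (succ n)" using has_card_D_fin_atoms[OF faz succ_om[OF n(1)]] z(2) by blast
  moreover have "mem M n (succ n)" by (simp add: mem_succ)
  ultimately have zgt: "z \<in> subsets_gt M D (ext M D y) n"
    using z(1) zset fin_atoms_D[OF faz] succ_om[OF n(1)]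
    by (auto simp: subsets_gt_def finite_gt_def omega_D ext_D y(1))
  obtain w where w: "w \<in> subsets_eq M D (ext M D y) n" "mp f z w" using is_fun_total[OF fn' zgt] by blast
  then have wD: "w \<in> D" and wset: "is_set M w" and wn: "has_card M UNIV w n"
    using has_card_UNIV D_om[OF n(1)] by (auto simp: subsets_eq_def)
  have wz: "mem M b z" if "mem M b w" for b
    using sub[OF zgt wD] w(2) wD fin_atoms_D[OF faz] that by (auto simp: mp_D f subset_of_def ext_D)
  \<comment> \<open>Here \<open>n \<noteq> zero\<close> enters: \<open>n\<close> has a member, which
    the bijection carries into \<open>w\<close>.\<close>
  obtain a where a: "mem M a w"
  proof -
    have "Ext M n \<noteq> {}" using n eq_zero om_set by blast
    then obtain j where "j \<in> Ext M n" by blast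
    moreover obtain g where "is_bij M UNIV g (Ext M n) (Ext M w)" using wn has_card_iff by blast
    ultimately show thesis using that is_fun_total[OF is_bij_fun] by fastforce
  qed
  \<comment> \<open>Otherwise \<open>w = z\<close>, and \<open>z\<close> would have both cardinality
    \<open>n\<close> and cardinality \<open>succ n\<close>.\<close>
  obtain b where b: "mem M b z" "\<not> mem M b w"
  proof (rule ccontr)
    assume "\<not> thesis"
    then have "w = z" using that wz by (intro set_ext wset zset) blast
    then show False
      using has_card_neq[OF n(1) succ_om[OF n(1)] _ wn] z(2) by (simp add: mem_succ)
  qed
  obtain \<tau> where \<tau>: "\<tau> \<in> fix_group M s" "act \<tau> a = b" "act \<tau> b = a"
    "\<And>c. c \<in> At \<Longrightarrow> c \<noteq> a \<Longrightarrow> c \<noteq> b \<Longrightarrow> act \<tau> c = c"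
    using fix_swap[OF fin_atoms_mem[OF faz wz[OF a]] fin_atoms_mem[OF faz b(1)] _ _ s(1)] z(1) wz[OF a] b(1) by metis
  note p = fix_perms[OF \<tau>(1)]
  \<comment> \<open>Since \<open>a\<close> and \<open>b\<close> both lie in \<open>z\<close>, the
    transposition \<open>\<tau>\<close> is an involution of \<open>z\<close>.\<close>
  have zz: "mem M (act \<tau> c) z" "act \<tau> (act \<tau> c) = c" if c: "mem M c z" for c
    using wz[OF a] b(1) c \<tau>(2,3) \<tau>(4)[OF fin_atoms_mem[OF faz c]]
    by (cases "c = a"; cases "c = b"; simp)+
  have "act \<tau> ` Ext M z = Ext M z"
  proof
    show "Ext M z \<subseteq> act \<tau> ` Ext M z"
    proof
      fix c assume "c \<in> Ext M z"
      then show "c \<in> act \<tau> ` Ext M z" using zz by (intro image_eqI[of c "act \<tau>" "act \<tau> c"]) simp_all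
    qed
  qed (use zz(1) in auto)
  then have "act \<tau> z = z"
    using mk_Ext[of "act \<tau> z"] mk_Ext[OF zset] Ext_act[OF p] is_set_act[OF p] zset by simp
  moreover have "act \<tau> f = f" using s(2) \<tau>(1) by (simp add: supp_def)
  \<comment> \<open>Fixing \<open>f\<close> and \<open>z\<close>, the permutation must fix the value
    \<open>w\<close>; but it sends \<open>a\<close>, which is in \<open>w\<close>, to
    \<open>b\<close>, which is not.\<close>
  ultimately have "mp f z (act \<tau> w)" using mp_act[OF p, of f z w] w(2) by simp
  then have "act \<tau> w = w" using is_fun_fun[OF fn'] w(2) by blast
  then show False using mem_act[OF p, of a w] a b(2) \<tau>(2) by simp
qed

section \<open>Choice of subsets on an infinite subfamily\<close>

lemma supp_elem_of_finite:
  assumes "x \<in> D" "m \<in> om" "has_card M D x m" "fin_atoms u" "supp u x" "mem M y x"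
  shows "supp u y"
  using has_card_uniform_support[OF assms(1-3)] supp_elem_of_uniformly_supported assms(4-6) by blast

text \<open>Collects the relativised part of the conclusion common to both cases, so that each has
  to provide only \<open>B\<close>, the choice \<open>h\<close> and a graph of \<open>h\<close>
  lying in \<open>D\<close>.\<close>

lemma nC_witness:
  assumes B: "B \<in> D" and f: "f \<in> D" "is_set M f" "\<And>p. mem M p f \<longleftrightarrow> (\<exists>X\<in>Ext M B. p = pr X (h X))"
    and h: "\<And>X. mem M X B \<Longrightarrow> h X \<in> D \<and> is_set M X \<and> is_set M (h X) \<and> Ext M (h X) \<subseteq> Ext M X \<and>
      has_card M D (h X) n"
  shows "is_fun M D f (ext M D B) (subsets_eq M D (\<Union>X \<in> ext M D B. ext M D X) n) \<and>
    (\<forall>X \<in> ext M D B. \<forall>w\<in>D. maps_to M D f X w \<longrightarrow> subset_of M D w X)"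
proof -
  have fm: "mp f X w \<longleftrightarrow> mem M X B \<and> w = h X" for X w
    by (auto simp: mp_iff f(3))
  have XD: "X \<in> D" if "mem M X B" for X using D_mem[OF B that] .
  have hs: "h X \<in> subsets_eq M D (\<Union>X \<in> ext M D B. ext M D X) n" if X: "mem M X B" for X
  proof -
    have "Ext M (h X) \<subseteq> (\<Union>X \<in> ext M D B. ext M D X)"
      using h[OF X] X XD[OF X] by (auto simp: ext_D B subset_iff intro!: bexI[of _ X])
    then show ?thesis using h[OF X] by (simp add: subsets_eq_def ext_D)
  qed
  have "is_fun M UNIV f (Ext M B) (subsets_eq M D (\<Union>X \<in> ext M D B. ext M D X) n)"
    unfolding is_fun_iff fm f(3) using f(2) hs by auto
  moreover have "subset_of M D (h X) X" if "mem M X B" for X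
    using h[OF that] XD[OF that] by (simp add: subset_of_def ext_D)
  ultimately show ?thesis by (simp add: is_fun_D f(1) mp_D fm ext_D[OF B])
qed

lemma nC_fin_minus_D:
  assumes AC: "model_AC M" and n: "n \<in> om"
  shows "nC_fin_minus M D n"
  unfolding nC_fin_minus_def
proof (intro ballI impI)
  fix F assume F: "F \<in> D" and inf: "infinite_set M D F \<and> (\<forall>X\<in>ext M D F. finite_gt M D X n)"
  have Fset: "is_set M F" using inf by (simp add: infinite_set_def)
  have XD: "X \<in> D" if "mem M X F" for X using D_mem[OF F that] .
  have card: "\<exists>m. m \<in> om \<and> mem M n m \<and> has_card M D X m" if "mem M X F" for X
    using inf that by (auto simp: ext_D F finite_gt_def omega_D)
  have Xset: "is_set M X" if "mem M X F" for X using card[OF that] by (auto simp: has_card_def)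
  have sub: "\<exists>Y. is_set M Y \<and> Ext M Y \<subseteq> Ext M X \<and> has_card M UNIV Y n" if "mem M X F" for X
    using card[OF that] ex_subset_card has_card_UNIV XD[OF that] D_om by blast
  \<comment> \<open>An \<open>n\<close>-subset of \<open>X\<close> found in \<open>M\<close> already
    lies in \<open>D\<close>: every support of \<open>X\<close> supports all elements of the finite
    set \<open>X\<close>, hence the subset and its enumerations.\<close>
  have D_sub: "Y \<in> D \<and> supp u Y \<and> has_card M D Y n"
    if "mem M X F" "fin_atoms u" "supp u X" "is_set M Y" "Ext M Y \<subseteq> Ext M X" "has_card M UNIV Y n" for X Y u
  proof -
    have "y \<in> D \<and> supp u y" if "mem M y Y" for y
      using card[OF \<open>mem M X F\<close>] supp_elem_of_finite[OF XD[OF \<open>mem M X F\<close>] _ _ \<open>fin_atoms u\<close> \<open>supp u X\<close>]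
        D_mem[OF XD[OF \<open>mem M X F\<close>]] \<open>Ext M Y \<subseteq> Ext M X\<close> that by (auto simp: subset_iff)
    then show ?thesis
      using that D_elems[of u Y] supp_elems[of Y u] has_card_D_iff[OF n, of u Y] by blast
  qed
  obtain s where s: "fin_atoms s" "supp s F" using D_supp[OF F] by blast
  show "\<exists>B\<in>D. subset_of M D B F \<and> infinite_set M D B \<and>
    (\<exists>f\<in>D. is_fun M D f (ext M D B) (subsets_eq M D (\<Union>X\<in>ext M D B. ext M D X) n) \<and>
      (\<forall>X\<in>ext M D B. \<forall>w\<in>D. maps_to M D f X w \<longrightarrow> subset_of M D w X))"
  proof (cases "\<forall>X. mem M X F \<longrightarrow> supp s X")
    case True
    \<comment> \<open>All \<open>n\<close>-subsets of \<open>X\<close>, taken in \<open>M\<close>,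
      where the axiom of choice picks one of them for each \<open>X\<close>.\<close>
    define C where "C X = {Y. is_set M Y \<and> Ext M Y \<subseteq> Ext M X \<and> has_card M UNIV Y n}" for X
    have "definable M (\<lambda>e. is_set M (e 0) \<and> (\<forall>w. mem M w (e 0) \<longrightarrow> mem M w X) \<and> has_card M UNIV (e 0) n)" for X
      by (intro definable_intros)
    then have "definable M (\<lambda>e. e 0 \<in> C X)" for X by (simp add: C_def subset_iff)
    then have C: "small (C X)" for X
      by (rule small_subset[OF small_Pow[OF small_Ext[of X]], rotated]) (auto simp: C_def)
    let ?R = "\<lambda>X Z. is_set M Z \<and> (\<forall>Y. mem M Y Z \<longleftrightarrow>
      is_set M Y \<and> (\<forall>w. mem M w Y \<longrightarrow> mem M w X) \<and> has_card M UNIV Y n)"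
    have dR: "definable M (\<lambda>e. ?R (e 0) (e 1))" by (intro definable_intros)
    have R: "?R X Z \<longleftrightarrow> Z = mk (C X)" for X Z
    proof -
      have "?R X Z \<longleftrightarrow> is_set M Z \<and> Ext M Z = C X" by (simp add: C_def set_eq_iff subset_iff)
      then show ?thesis using mk_unique is_set_mk[OF C] Ext_mk[OF C] by metis
    qed
    have sG: "small ((\<lambda>X. mk (C X)) ` Ext M F)" by (rule small_image[OF small_Ext dR R])
    let ?G = "mk ((\<lambda>X. mk (C X)) ` Ext M F)"
    have "Ext M Z \<noteq> {}" if Z: "Z \<in> Ext M ?G" for Z
    proof -
      obtain X where X: "mem M X F" "Z = mk (C X)" using Z unfolding Ext_mk[OF sG] by auto
      obtain Y where "Y \<in> C X" using sub[OF X(1)] unfolding C_def by blast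
      then show ?thesis unfolding X(2) Ext_mk[OF C] by blast
    qed
    then obtain c where c: "is_fun M UNIV c (Ext M ?G) (\<Union>Z\<in>Ext M ?G. Ext M Z)"
      and cmem: "\<And>Z w. Z \<in> Ext M ?G \<Longrightarrow> mp c Z w \<Longrightarrow> mem M w Z"
      using AC is_set_mk[OF sG] unfolding model_AC_def by blast
    define h where "h X = (THE Y. mp c (mk (C X)) Y)" for X
    have G: "mk (C X) \<in> Ext M ?G" if "X \<in> Ext M F" for X using that unfolding Ext_mk[OF sG] by blast
    have h: "mp c (mk (C X)) Y \<longleftrightarrow> Y = h X" if "X \<in> Ext M F" for X Y
      using is_fun_total[OF c G[OF that]] is_fun_fun[OF c] unfolding h_def by (metis the_equality)
    have hC: "h X \<in> C X" if "X \<in> Ext M F" for X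
      using cmem[OF G[OF that]] h[OF that] mem_mk[OF C] by blast
    \<comment> \<open>The graph of \<open>h\<close> is expressed by quantifying over the code
      \<open>Z\<close> of \<open>C X\<close>, which is not a term.\<close>
    have d: "definable M (\<lambda>e. \<exists>Z. ?R (e 0) Z \<and> mp c Z (e 1))" by (intro definable_intros)
    have Rh: "(\<exists>Z. ?R X Z \<and> mp c Z Y) \<longleftrightarrow> Y = h X" if "X \<in> Ext M F" for X Y
      unfolding R using h[OF that] by simp
    obtain f where f: "is_set M f" "\<And>p. mem M p f \<longleftrightarrow> (\<exists>X\<in>Ext M F. p = pr X (h X))"
      by (rule obtain_fun[OF small_Ext[of F] d Rh]) (assumption, rule that)
    have hD: "h X \<in> D \<and> supp s (h X) \<and> has_card M D (h X) n" if "mem M X F" for X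
      using D_sub[OF that s(1)] True hC[of X] that by (simp add: C_def)
    \<comment> \<open>\<open>s\<close> supports every \<open>X\<close> in \<open>F\<close> and every
      chosen subset, hence every pair in \<open>f\<close>.\<close>
    have "f \<in> D"
      by (rule D_elems[OF s(1) f(1)]) (use True hD XD f(2) in \<open>auto intro: D_pr supp_pr\<close>)
    moreover have "h X \<in> D \<and> is_set M X \<and> is_set M (h X) \<and> Ext M (h X) \<subseteq> Ext M X \<and> has_card M D (h X) n"
      if "mem M X F" for X
      using hD[OF that] hC[of X] Xset[OF that] that by (simp add: C_def)
    moreover have "subset_of M D F F" using Fset by (simp add: subset_of_def)
    ultimately show ?thesis using nC_witness[OF F _ f] F inf by blast
  next
    case False
    then obtain X where X: "mem M X F" "\<not> supp s X" by blast
    obtain t where t: "fin_atoms t" "supp t X" using D_supp[OF XD[OF X(1)]] by blast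
    obtain w a where w: "fin_atoms w" "Ext M s \<subseteq> Ext M w" and a: "a \<in> At" "\<not> mem M a w"
      and wX: "supp (ins a w) X" "\<not> supp w X"
      using supp_last_atom[OF s(1) t X(2)] by metis
    obtain Y where Y: "is_set M Y" "Ext M Y \<subseteq> Ext M X" "has_card M UNIV Y n" using sub[OF X(1)] by blast
    then have YD: "Y \<in> D" "supp (ins a w) Y" "has_card M D Y n"
      using D_sub[OF X(1) fin_atoms_ins[OF w(1) a(1)] wX(1)] by blast+
    \<comment> \<open>Well-definedness of the choice on the orbit. If \<open>w\<close> supports
      \<open>Y\<close>, both sides equal \<open>Y\<close>; otherwise both equations amount to
      \<open>act \<pi> a = act \<rho> a\<close>.\<close>
    have same: "act \<pi> Y = act \<rho> Y"
      if "act \<pi> X = act \<rho> X" "\<pi> \<in> fix_group M w" "\<rho> \<in> fix_group M w" for \<pi> \<rho>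
    proof (cases "supp w Y")
      case True then show ?thesis using that by (simp add: supp_def)
    next
      case False
      show ?thesis
        using act_eq_iff_last_atom[OF w(1) a wX that(2,3)]
          act_eq_iff_last_atom[OF w(1) a YD(2) False that(2,3)] that(1) by blast
    qed
    have inF: "mem M (act \<pi> X) F" if "\<pi> \<in> fix_group M w" for \<pi>
      using supp_mem[OF s(2) fix_antimono[OF w(2) that]] X(1) by blast
    \<comment> \<open>\<open>perm_app\<close> is known to agree with \<open>act\<close> only for
      permutations, so membership in the stabilizer is carried along.\<close>
    have app: "\<pi> \<in> fix_group M w \<and> perm_app M \<pi> x y \<longleftrightarrow> \<pi> \<in> fix_group M w \<and> y = act \<pi> x" for \<pi> x y
      using perm_app_iff fix_perms by blast
    \<comment> \<open>The orbit of \<open>X\<close>; the conjunct \<open>mem M Z F\<close> makes it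
      an instance of separation.\<close>
    let ?B = "{Z. mem M Z F \<and> (\<exists>\<pi>. \<pi> \<in> fix_group M w \<and> perm_app M \<pi> X Z)}"
    let ?b = "mk ?B"
    have sB: "small ?B" by (rule small_sep) (intro definable_intros)
    have B: "mem M Z ?b \<longleftrightarrow> (\<exists>\<pi>\<in>fix_group M w. Z = act \<pi> X)" for Z
    proof -
      have "mem M Z ?b \<longleftrightarrow> mem M Z F \<and> (\<exists>\<pi>. \<pi> \<in> fix_group M w \<and> perm_app M \<pi> X Z)"
        by (simp only: mem_mk[OF sB] mem_Collect_eq)
      also have "\<dots> \<longleftrightarrow> (\<exists>\<pi>\<in>fix_group M w. Z = act \<pi> X)" unfolding app using inF by blast
      finally show ?thesis .
    qed
    \<comment> \<open>The graph of the choice sending \<open>act \<pi> X\<close> to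
      \<open>act \<pi> Y\<close>. It is definable because permutations are elements of
      \<open>M\<close> and can be quantified over.\<close>
    let ?R = "\<lambda>Z V. \<exists>\<pi>. (\<pi> \<in> fix_group M w \<and> perm_app M \<pi> X Z) \<and> (\<pi> \<in> fix_group M w \<and> perm_app M \<pi> Y V)"
    have dR: "definable M (\<lambda>e. ?R (e 0) (e 1))" by (intro definable_intros)
    define h where "h Z = (THE V. ?R Z V)" for Z
    have R: "?R (act \<pi> X) V \<longleftrightarrow> V = act \<pi> Y" if "\<pi> \<in> fix_group M w" for \<pi> V
      unfolding app using same that by metis
    have hact: "h (act \<pi> X) = act \<pi> Y" if "\<pi> \<in> fix_group M w" for \<pi>
      unfolding h_def using R[OF that] by simp
    have Rh: "?R Z V \<longleftrightarrow> V = h Z" if Z: "Z \<in> Ext M ?b" for Z V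
    proof -
      obtain \<pi> where \<pi>: "\<pi> \<in> fix_group M w" "Z = act \<pi> X" using Z unfolding ext_UNIV B by blast
      show ?thesis unfolding \<pi>(2) hact[OF \<pi>(1)] by (rule R[OF \<pi>(1)])
    qed
    obtain f where f: "is_set M f" "\<And>p. mem M p f \<longleftrightarrow> (\<exists>Z\<in>Ext M ?b. p = pr Z (h Z))"
      by (rule obtain_fun[OF small_Ext[of ?b] dR Rh]) (assumption, rule that)
    have f': "mem M p f \<longleftrightarrow> (\<exists>\<pi>\<in>fix_group M w. p = pr (act \<pi> X) (act \<pi> Y))" for p
      unfolding f(2) Bex_def ext_UNIV B using hact by metis
    have actD: "act \<pi> X \<in> D" "act \<pi> Y \<in> D" if "\<pi> \<in> fix_group M w" for \<pi>
      using D_act[OF fix_perms[OF that]] XD[OF X(1)] YD(1) by blast+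
    \<comment> \<open>The stabilizer of \<open>w\<close> is closed under composition, so it maps the
      orbit into itself; the same argument applies to \<open>f\<close>.\<close>
    have "supp w ?b"
    proof (rule suppI)
      fix \<pi> Z assume \<pi>: "\<pi> \<in> fix_group M w" and "mem M Z ?b"
      then obtain \<rho> where \<rho>: "\<rho> \<in> fix_group M w" "Z = act \<rho> X" unfolding B by blast
      obtain \<tau> where "\<tau> \<in> fix_group M w" "\<And>x. act \<tau> x = act \<pi> (act \<rho> x)"
        using fix_comp[OF \<pi> \<rho>(1)] by metis
      then show "mem M (act \<pi> Z) ?b" unfolding B using \<rho>(2) by metis
    qed (rule is_set_mk[OF sB])
    then have bD: "?b \<in> D" by (rule D_I[OF w(1)]) (use B actD in auto)
    have "supp w f"
    proof (rule suppI)
      fix \<pi> p assume \<pi>: "\<pi> \<in> fix_group M w" and "mem M p f"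
      then obtain \<rho> where \<rho>: "\<rho> \<in> fix_group M w" "p = pr (act \<rho> X) (act \<rho> Y)" unfolding f' by blast
      obtain \<tau> where "\<tau> \<in> fix_group M w" "\<And>x. act \<tau> x = act \<pi> (act \<rho> x)"
        using fix_comp[OF \<pi> \<rho>(1)] by metis
      then show "mem M (act \<pi> p) f" unfolding f' using \<rho>(2) act_pr[OF fix_perms[OF \<pi>]] by metis
    qed (rule f(1))
    then have fD: "f \<in> D" by (rule D_I[OF w(1)]) (use f' actD D_pr in auto)
    have "infinite_set M D ?b"
    proof (rule infinite_D_I[OF bD is_set_mk[OF sB]])
      fix v assume "fin_atoms v"
      then obtain \<pi> where "\<pi> \<in> fix_group M w" "\<not> supp v (act \<pi> X)"
        using unsupported_translate[OF w(1) a wX] by metis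
      then show "\<exists>y. mem M y ?b \<and> \<not> supp v y" unfolding B by blast
    qed
    moreover have "subset_of M D ?b F"
      using is_set_mk[OF sB] Fset inF B by (auto simp: subset_of_def ext_D bD F)
    moreover have "h Z \<in> D \<and> is_set M Z \<and> is_set M (h Z) \<and> Ext M (h Z) \<subseteq> Ext M Z \<and> has_card M D (h Z) n"
      if Z: "mem M Z ?b" for Z
    proof -
      obtain \<pi> where \<pi>: "\<pi> \<in> fix_group M w" "Z = act \<pi> X" using Z unfolding B by blast
      note p = fix_perms[OF \<pi>(1)]
      have "Ext M (act \<pi> Y) \<subseteq> Ext M (act \<pi> X)" using Y(2) unfolding Ext_act[OF p] by blast
      then show ?thesis
        using actD[OF \<pi>(1)] is_set_act[OF p] Xset[OF X(1)] Y(1) has_card_act[OF p YD(1) n YD(3)]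
        unfolding \<pi>(2) hact[OF \<pi>(1)] by simp
    qed
    ultimately show ?thesis using nC_witness[OF bD fD f] bD fD by blast
  qed
qed

end

theorem theorem5p1:
  fixes M :: "'v zfa"
  assumes "model_ZFA M" and "model_AC M" and "countable_atoms M"
  shows "\<forall>n \<in> omega M (BFM M). ext M (BFM M) n \<noteq> {} \<longrightarrow>
           nC_fin_minus M (BFM M) n \<and> \<not> nRC_fin M (BFM M) n"
proof -
  interpret zfa_model M by (rule zfa_model.intro) (rule assms(1))
  interpret infinite_atoms M
    by unfold_locales (rule countable_atoms_infinite[OF assms(3)])
  have "n \<noteq> zero" if "ext M (BFM M) n \<noteq> {}" for n
    using that not_mem_zero by (auto simp: ext_def)
  then show ?thesis
    using nC_fin_minus_D[OF assms(2)] not_nRC_fin unfolding omega_D by blast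
qed

end
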